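(* Let $n$ be a positive integer and write $8n+19=3^{\beta}n_1$ with $n_1$ a positive integer and $3\nmid n_1$. Then $$t(1,3,3,12;n)=\frac 12\Big(3^{\beta}\Big(\frac 3{n_1}\Big)-1\Big)\sum_{d\mid n_1}d\Big(\frac 3d\Big)+\frac12\sum_{\substack{a,b\in\mathbb N,\ a\equiv b\equiv 1\ (\mathrm{mod}\ 2)\\ 4(8n+19)=a^2+3b^2}}\big((-1)^{\frac{a-1}2}a+(-1)^{\frac{b-1}2}b\big),$$ where $d$ runs over positive divisors of $n_1$.
   Context: $\mathbb N$ is the set of positive integers and $\left(\frac{a}{m}\right)$ is the Legendre–Jacobi–Kronecker symbol. For positive integers $a,b,c,d$ and a nonnegative integer $n$, $t(a,b,c,d;n)$ denotes the number of $(x,y,z,w)\in\mathbb Z^4$ with $n=a\frac{x(x-1)}2+b\frac{y(y-1)}2+c\frac{z(z-1)}2+d\frac{w(w-1)}2$. *)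

theory Defs
  imports Complex_Main "HOL-Number_Theory.Number_Theory"
begin

text \<open>
  The Legendre--Jacobi--Kronecker symbol, the completely multiplicative extension in the lower
  argument of the symbols at primes, the prime 2 and the unit \<open>-1\<close>, with the usual
  convention at 0.
\<close>

definition kronecker_prime :: "int \<Rightarrow> int \<Rightarrow> int" where
  "kronecker_prime a p =
     (if p = 2 then (if even a then 0 else if a mod 8 \<in> {1, 7} then 1 else -1)
      else Legendre a p)"

definition kronecker :: "int \<Rightarrow> int \<Rightarrow> int" where
  "kronecker a m =
     (if m = 0 then (if \<bar>a\<bar> = 1 then 1 else 0)
      else (if m < 0 \<and> a < 0 then -1 else 1) *
        (\<Prod>p\<in>prime_factors m. kronecker_prime a p ^ multiplicity p m))"

text \<open>
  The set is finite when \<open>a, b, c, d\<close> are positive, and \<open>x * (x - 1)\<close>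
  is always even, so \<open>div\<close> is exact here.
\<close>

definition tri_reps :: "nat \<Rightarrow> nat \<Rightarrow> nat \<Rightarrow> nat \<Rightarrow> nat \<Rightarrow> nat" where
  "tri_reps a b c d n = card {(x :: int, y :: int, z :: int, w :: int).
     int n = int a * (x * (x - 1) div 2) + int b * (y * (y - 1) div 2)
           + int c * (z * (z - 1) div 2) + int d * (w * (w - 1) div 2)}"

end

theory Submission
  imports Defs "HOL-Computational_Algebra.Formal_Power_Series"
begin

text \<open>
  Put \<open>N = 8 n + 19\<close>, so that \<open>t(1,3,3,12;n)\<close> counts the solutions of
  \<open>N = x\<^sup>2 + 3 y\<^sup>2 + 3 z\<^sup>2 + 3 u\<^sup>2\<close> with \<open>x, y, z\<close> odd and \<open>u\<close> even. Write \<open>O\<^sub>k\<close> and \<open>E\<^sub>k\<close>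
  for the sums of \<open>q\<close> to the power \<open>k x\<^sup>2\<close> over odd and even \<open>x\<close>. Then twice the counting series is
  \<open>O\<^sub>3 E\<^sub>3 (O\<^sub>1 O\<^sub>3 + E\<^sub>1 E\<^sub>3) + O\<^sub>3 E\<^sub>3 (O\<^sub>1 O\<^sub>3 - E\<^sub>1 E\<^sub>3)\<close>.

  In the second term the hexagonal symmetry and Jacobi's identity for the cube of Euler's product
  leave the binary sum over \<open>N = 3 v\<^sup>2 + u\<^sup>2\<close>, which multiplication by a cube root of unity turns
  into the sum over \<open>4 N = a\<^sup>2 + 3 b\<^sup>2\<close>.

  The first term is a convolution of the representation numbers of the norm forms of the Gaussian
  and the Eisenstein integers, that is, of divisor sums of the characters modulo 4 and 3. A
  Liouville-type argument evaluates it: the move \<open>(a, b, x, y) \<mapsto> (a, b - a, x + y, y)\<close>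
  on the positive solutions of \<open>a x + b y = N\<close> reduces a suitable weighted sum to its
  boundary terms \<open>a = b\<close> and \<open>x = y\<close>, which are divisor sums.
\<close>

unbundle fps_syntax

section \<open>Characters and a Liouville identity\<close>

text \<open>For odd x and y the value x^2 + 3 y^2 is 4 modulo 8, so the product of the two odd
  series alone reaches only every second multiple of 4, while the Liouville argument evaluates a
  convolution over all of them. Adding the product of the two even series completes the pairs to the
  lattice x = y (mod 2), on which x^2 + 3 y^2 is four times the Eisenstein norm. What has to be
  subtracted again is the cuspidal part of the answer.

  The naive weight \<open>chi4 x * chi3 y\<close> is not compatible with the Liouville move. The
  weights are instead built from a rotation of order six that preserves a x + b y; the price is a
  number of unwanted convolutions. They vanish because N = 3 (mod 4): the divisor sum of
  \<open>chi4\<close> is zero at arguments that are 3 modulo 4, and a factor 2 can be moved between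
  complementary divisors in all other terms.

  The term \<open>R4 (N div 3)\<close> arises twice: from the divisors divisible by 3 on a boundary
  of the Liouville sum, and from the constant coefficient of the Eisenstein series. The two
  occurrences match, so it is absent from the final formula.\<close>

definition chi4 :: "int \<Rightarrow> int" where
  "chi4 x = (if x mod 4 = 1 then 1 else if x mod 4 = 3 then -1 else 0)"

definition chi3 :: "int \<Rightarrow> int" where
  "chi3 x = (if x mod 3 = 1 then 1 else if x mod 3 = 2 then -1 else 0)"

lemma chi4_minus: "chi4 (- x) = - chi4 x"
  unfolding chi4_def by presburger

lemma chi3_minus: "chi3 (- x) = - chi3 x"
  unfolding chi3_def by presburger

lemma chi4_mult: "chi4 (x * y) = chi4 x * chi4 y"
proof -
  define r s where "r = x mod 4" and "s = y mod 4"
  have "x * y mod 4 = r * s mod 4" by (simp add: r_def s_def mod_mult_eq)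
  moreover have "r \<in> {0,1,2,3}" "s \<in> {0,1,2,3}" by (auto simp: r_def s_def)
  ultimately show ?thesis unfolding chi4_def r_def[symmetric] s_def[symmetric] by auto
qed

lemma chi3_mult: "chi3 (x * y) = chi3 x * chi3 y"
proof -
  define r s where "r = x mod 3" and "s = y mod 3"
  have "x * y mod 3 = r * s mod 3" by (simp add: r_def s_def mod_mult_eq)
  moreover have "r \<in> {0,1,2}" "s \<in> {0,1,2}" by (auto simp: r_def s_def)
  ultimately show ?thesis unfolding chi3_def r_def[symmetric] s_def[symmetric] by auto
qed

lemma chi4_even: "even x \<Longrightarrow> chi4 x = 0"
  unfolding chi4_def by presburger

section \<open>Positive solutions of a x + b y = N and the Liouville move\<close>

definition quads :: "int \<Rightarrow> (int \<times> int \<times> int \<times> int) set" where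
  "quads N = {(a, b, x, y). 0 < a \<and> 0 < b \<and> 0 < x \<and> 0 < y \<and> a * x + b * y = N}"

lemma finite_quads: "finite (quads N)"
proof (rule finite_subset)
  show "quads N \<subseteq> {0..N} \<times> {0..N} \<times> {0..N} \<times> {0..N}"
  proof (clarsimp simp: quads_def)
    fix a b x y :: int
    assume p: "0 < a" "0 < b" "0 < x" "0 < y"
    have "a * 1 \<le> a * x" "1 * x \<le> a * x" "b * 1 \<le> b * y" "1 * y \<le> b * y"
      using p by (intro mult_left_mono mult_right_mono; simp)+
    moreover have "0 < a * x" "0 < b * y" using p by simp_all
    ultimately show "a \<le> a * x + b * y \<and> b \<le> a * x + b * y \<and> x \<le> a * x + b * y \<and> y \<le> a * x + b * y"
      by linarith
  qed
qed auto

lemma quads_shift: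
  fixes F :: "int \<Rightarrow> int \<Rightarrow> int \<Rightarrow> int \<Rightarrow> int"
  shows "(\<Sum>(a, b, x, y) | (a, b, x, y) \<in> quads N \<and> a < b. F a b x y) =
         (\<Sum>(a, b, x, y) | (a, b, x, y) \<in> quads N \<and> y < x. F a (a + b) (x - y) y)"
  by (rule sum.reindex_bij_witness
        [where i = "\<lambda>(a, b, x, y). (a, a + b, x - y, y)" and j = "\<lambda>(a, b, x, y). (a, b - a, x + y, y)"])
     (auto simp: quads_def algebra_simps)

lemma quads_swap:
  fixes F :: "int \<Rightarrow> int \<Rightarrow> int \<Rightarrow> int \<Rightarrow> int"
  assumes "\<And>a b x y. P a b x y \<longleftrightarrow> P' b a y x"
  shows "(\<Sum>(a, b, x, y) | (a, b, x, y) \<in> quads N \<and> P a b x y. F a b x y) =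
         (\<Sum>(a, b, x, y) | (a, b, x, y) \<in> quads N \<and> P' a b x y. F b a y x)"
  by (rule sum.reindex_bij_witness
        [where i = "\<lambda>(a, b, x, y). (b, a, y, x)" and j = "\<lambda>(a, b, x, y). (b, a, y, x)"])
     (auto simp: quads_def algebra_simps assms)

lemma quads_trichotomy:
  fixes F :: "int \<Rightarrow> int \<Rightarrow> int \<Rightarrow> int \<Rightarrow> int" and u v :: "int \<times> int \<times> int \<times> int \<Rightarrow> int"
  shows "(\<Sum>(a, b, x, y) \<in> quads N. F a b x y) =
         (\<Sum>(a, b, x, y) | (a, b, x, y) \<in> quads N \<and> u (a, b, x, y) < v (a, b, x, y). F a b x y)
       + (\<Sum>(a, b, x, y) | (a, b, x, y) \<in> quads N \<and> v (a, b, x, y) < u (a, b, x, y). F a b x y)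
       + (\<Sum>(a, b, x, y) | (a, b, x, y) \<in> quads N \<and> u (a, b, x, y) = v (a, b, x, y). F a b x y)"
proof -
  let ?f = "\<lambda>(a, b, x, y). F a b x y"
  let ?A = "{(a, b, x, y). (a, b, x, y) \<in> quads N \<and> u (a, b, x, y) < v (a, b, x, y)}"
  let ?B = "{(a, b, x, y). (a, b, x, y) \<in> quads N \<and> v (a, b, x, y) < u (a, b, x, y)}"
  let ?C = "{(a, b, x, y). (a, b, x, y) \<in> quads N \<and> u (a, b, x, y) = v (a, b, x, y)}"
  have fin: "finite ?A" "finite ?B" "finite ?C"
    by (rule finite_subset[OF _ finite_quads[of N]]; auto)+
  have "quads N = (?A \<union> ?B) \<union> ?C" by auto
  hence "sum ?f (quads N) = sum ?f ((?A \<union> ?B) \<union> ?C)" by simp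
  also have "\<dots> = sum ?f (?A \<union> ?B) + sum ?f ?C"
    using fin by (intro sum.union_disjoint) auto
  also have "sum ?f (?A \<union> ?B) = sum ?f ?A + sum ?f ?B"
    using fin by (intro sum.union_disjoint) auto
  finally show ?thesis .
qed

text \<open>The move carries the half a < b of the sum of \<open>F\<close> onto the half y < x of
  the sum of \<open>G\<close>, and its conjugate under exchanging (a, x) with (b, y) carries b < a
  onto x < y. What remains are the diagonals, where the move or its inverse would produce a zero
  entry.\<close>

lemma liouville_identity:
  fixes F G :: "int \<Rightarrow> int \<Rightarrow> int \<Rightarrow> int \<Rightarrow> int"
  assumes 1: "\<And>a b x y. F a (a + b) (x - y) y = G a b x y"
    and 2: "\<And>a b x y. F (a + b) b x (y - x) = G a b x y"
  shows "(\<Sum>(a, b, x, y) \<in> quads N. F a b x y) - (\<Sum>(a, b, x, y) \<in> quads N. G a b x y) =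
         (\<Sum>(a, b, x, y) | (a, b, x, y) \<in> quads N \<and> a = b. F a b x y)
       - (\<Sum>(a, b, x, y) | (a, b, x, y) \<in> quads N \<and> x = y. G a b x y)"
proof -
  have A: "(\<Sum>(a, b, x, y) | (a, b, x, y) \<in> quads N \<and> a < b. F a b x y) =
        (\<Sum>(a, b, x, y) | (a, b, x, y) \<in> quads N \<and> y < x. G a b x y)"
    by (simp add: quads_shift 1)
  have "(\<Sum>(a, b, x, y) | (a, b, x, y) \<in> quads N \<and> b < a. F a b x y) =
        (\<Sum>(a, b, x, y) | (a, b, x, y) \<in> quads N \<and> a < b. F b a y x)"
    by (rule quads_swap) auto
  also have "\<dots> = (\<Sum>(a, b, x, y) | (a, b, x, y) \<in> quads N \<and> y < x. F (a + b) a y (x - y))"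
    by (rule quads_shift)
  also have "\<dots> = (\<Sum>(a, b, x, y) | (a, b, x, y) \<in> quads N \<and> y < x. G b a y x)"
    by (subst add.commute) (simp add: 2)
  also have "\<dots> = (\<Sum>(a, b, x, y) | (a, b, x, y) \<in> quads N \<and> x < y. G a b x y)"
    by (rule quads_swap) auto
  finally have B: "(\<Sum>(a, b, x, y) | (a, b, x, y) \<in> quads N \<and> b < a. F a b x y) =
      (\<Sum>(a, b, x, y) | (a, b, x, y) \<in> quads N \<and> x < y. G a b x y)" .
  show ?thesis
    using quads_trichotomy[of F N "\<lambda>(a, b, x, y). a" "\<lambda>(a, b, x, y). b"]
      quads_trichotomy[of G N "\<lambda>(a, b, x, y). x" "\<lambda>(a, b, x, y). y"] A B by simp
qed

text \<open>
  The weights below are chosen so that the order-six rotation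
  \<open>(a, b, x, y) \<mapsto> (b, b - a, x + y, - x)\<close> multiplies \<open>rot4\<close> and \<open>rot3\<close> by \<open>-1\<close>; hence their
  product satisfies the hypotheses of \<open>liouville_identity\<close>. The coefficients of \<open>rot3\<close> are those
  for which all convolutions except the wanted one cancel in \<open>sum_rot12_odd\<close>.
\<close>

definition rot4 :: "int \<Rightarrow> int \<Rightarrow> int \<Rightarrow> int \<Rightarrow> int" where
  "rot4 a b x y = (if odd x \<and> even y \<and> even b then chi4 x
     else if odd x \<and> odd y \<and> even a then chi4 y
     else if even x \<and> odd y \<and> even (a + b) then - chi4 (x + y) else 0)"

definition rot3 :: "int \<Rightarrow> int \<Rightarrow> int" where
  "rot3 x y = (if 3 dvd x then - chi3 y else chi3 x + 2 * chi3 y)"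

text \<open>The rotation permutes the three nonzero parity classes of (x, y) cyclically; the three
  branches of \<open>rot4\<close> are one value transported along this cycle, with a change of sign
  at each step.\<close>

lemma rot4_rotate: "rot4 b (b - a) (x + y) (- x) = - rot4 a b x y"
  by (cases "even x"; cases "even y"; cases "even a"; cases "even b"; simp add: rot4_def chi4_minus)

lemma chi3_mod: "chi3 (x mod 3) = chi3 x" by (simp add: chi3_def)

lemma rot3_mod: "rot3 (x mod 3) (y mod 3) = rot3 x y" by (simp add: rot3_def chi3_mod dvd_eq_mod_eq_0)

lemma rot3_rotate_residues: "r \<in> {0,1,2} \<Longrightarrow> s \<in> {0,1,2} \<Longrightarrow> rot3 (r+s) (-r) = - rot3 r s"
  by (elim insertE emptyE; simp add: rot3_def chi3_def)

lemma rot3_rotate: "rot3 (x + y) (- x) = - rot3 x y"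
proof -
  have "rot3 (x + y) (- x) = rot3 ((x mod 3 + y mod 3) mod 3) ((- (x mod 3)) mod 3)"
    by (subst rot3_mod[symmetric]) (simp only: mod_add_eq mod_minus_eq)
  also have "\<dots> = rot3 (x mod 3 + y mod 3) (- (x mod 3))" by (rule rot3_mod)
  also have "\<dots> = - rot3 (x mod 3) (y mod 3)" by (rule rot3_rotate_residues) auto
  also have "\<dots> = - rot3 x y" by (simp only: rot3_mod)
  finally show ?thesis .
qed

definition rot12 :: "int \<Rightarrow> int \<Rightarrow> int \<Rightarrow> int \<Rightarrow> int" where
  "rot12 a b x y = rot4 a b x y * rot3 x y"

lemma rot12_rotate: "rot12 b (b - a) (x + y) (- x) = rot12 a b x y"
  by (simp add: rot12_def rot4_rotate rot3_rotate)

text \<open>The quadruples (a, a + b, x - y, y), (a + b, b, x, y - x) and (b, -a, y, -x) are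
  successive points of one orbit of the rotation. Invariance under it therefore yields both
  hypotheses of \<open>liouville_identity\<close>, with the last point as the argument of
  \<open>G\<close>.\<close>

lemma rot12_rotate2: "rot12 (a + b) b x (y - x) = rot12 b (- a) y (- x)"
  using rot12_rotate[of b "a + b" x "y - x", symmetric] by simp

lemma rot12_rotate1: "rot12 a (a + b) (x - y) y = rot12 b (- a) y (- x)"
  unfolding rot12_rotate2[symmetric] using rot12_rotate[of "a + b" a "x - y" y, symmetric] by simp

section \<open>Divisor sums over factorizations\<close>

definition dpairs :: "int \<Rightarrow> (int \<times> int) set" where
  "dpairs n = {(a, x). 0 < a \<and> 0 < x \<and> a * x = n}"

lemma finite_dpairs: "finite (dpairs n)"
proof (rule finite_subset)
  show "dpairs n \<subseteq> {0..n} \<times> {0..n}"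
  proof
    fix t assume "t \<in> dpairs n"
    then obtain a x where t: "t = (a, x)" and p: "0 < a" "0 < x" and n: "a * x = n"
      by (auto simp: dpairs_def)
    have "a * 1 \<le> a * x" "1 * x \<le> a * x"
      using p by (intro mult_left_mono mult_right_mono; simp)+
    thus "t \<in> {0..n} \<times> {0..n}" using p by (simp add: t n)
  qed
qed auto

text \<open>For positive n this is a quarter of the number of representations by x^2 + y^2, and
  \<open>R3\<close> is a sixth of the number by x^2 + x y + y^2.\<close>

definition R4 :: "int \<Rightarrow> int" where "R4 n = (\<Sum>(a, x) \<in> dpairs n. chi4 x)"
definition R3 :: "int \<Rightarrow> int" where "R3 n = (\<Sum>(a, x) \<in> dpairs n. chi3 x)"

lemma dpairs_swap:
  fixes F :: "int \<Rightarrow> int \<Rightarrow> int"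
  shows "(\<Sum>(a, x) \<in> dpairs n. F a x) = (\<Sum>(a, x) \<in> dpairs n. F x a)"
  by (rule sum.reindex_bij_witness[where i = "\<lambda>(a, x). (x, a)" and j = "\<lambda>(a, x). (x, a)"])
     (auto simp: dpairs_def algebra_simps)

text \<open>Complementary divisors have opposite values of \<open>chi4\<close>, since the product of
  the values is -1. This removes the multiples of 4 among the \<open>L\<close> in
  \<open>sum_rot12_odd\<close>.\<close>

lemma R4_3_mod_4:
  assumes "n mod 4 = 3"
  shows "R4 n = 0"
proof -
  have "chi4 a = - chi4 x" if "(a, x) \<in> dpairs n" for a x
  proof -
    have "chi4 a * chi4 x = -1"
      unfolding chi4_mult[symmetric] using that assms by (auto simp: dpairs_def chi4_def)
    thus ?thesis by (auto simp: chi4_def split: if_splits)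
  qed
  hence "(\<Sum>(a, x) \<in> dpairs n. chi4 a) = (\<Sum>(a, x) \<in> dpairs n. - chi4 x)"
    by (intro sum.cong) auto
  hence "R4 n = - R4 n"
    using dpairs_swap[of "\<lambda>a x. chi4 a" n] by (simp add: R4_def sum_negf case_prod_unfold)
  thus ?thesis by simp
qed

lemma sum_chi4_3_dvd:
  "(\<Sum>(a, x) \<in> dpairs n. if 3 dvd x then chi4 x else 0) = (if 3 dvd n then - R4 (n div 3) else 0)"
proof (cases "3 dvd n")
  case False
  hence "\<not> 3 dvd x" if "(a, x) \<in> dpairs n" for a x using that by (auto simp: dpairs_def)
  thus ?thesis using False by (auto intro!: sum.neutral)
next
  case True
  have "(\<Sum>(a, x) \<in> dpairs n. if 3 dvd x then chi4 x else 0)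
      = (\<Sum>(a, x) \<in> {(a, x). (a, x) \<in> dpairs n \<and> 3 dvd x}. chi4 x)"
    by (rule sum.mono_neutral_cong_right) (auto simp: finite_dpairs split: if_splits)
  also have "\<dots> = (\<Sum>(a, x) \<in> dpairs (n div 3). - chi4 x)"
  proof (rule sum.reindex_bij_witness[where j = "\<lambda>(a, x). (a, x div 3)" and i = "\<lambda>(a, x). (a, 3 * x)"])
    have "chi4 (3 * z) = - chi4 z" for z by (simp add: chi4_mult) (simp add: chi4_def)
    thus "(case (case t of (a, x) \<Rightarrow> (a, x div 3)) of (a, x) \<Rightarrow> - chi4 x) = (case t of (a, x) \<Rightarrow> chi4 x)"
      if "t \<in> {(a, x). (a, x) \<in> dpairs n \<and> 3 dvd x}" for t
      using that by (auto elim!: dvdE)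
  qed (use True in \<open>auto simp: dpairs_def elim!: dvdE\<close>)
  finally show ?thesis using True by (simp add: R4_def sum_negf case_prod_unfold)
qed

lemma sum_chi3_even_even:
  "(\<Sum>(b, y) \<in> dpairs n. if even y \<and> even b then chi3 y else 0) = (if 4 dvd n then - R3 (n div 4) else 0)"
proof (cases "4 dvd n")
  case False
  hence "\<not> (even y \<and> even b)" if "(b, y) \<in> dpairs n" for b y
    using that mult_dvd_mono[of 2 b 2 y] by (auto simp: dpairs_def)
  thus ?thesis using False by (auto intro!: sum.neutral)
next
  case True
  have "(\<Sum>(b, y) \<in> dpairs n. if even y \<and> even b then chi3 y else 0)
      = (\<Sum>(b, y) \<in> {(b, y). (b, y) \<in> dpairs n \<and> even y \<and> even b}. chi3 y)"
    by (rule sum.mono_neutral_cong_right) (auto simp: finite_dpairs split: if_splits)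
  also have "\<dots> = (\<Sum>(b, y) \<in> dpairs (n div 4). - chi3 y)"
  proof (rule sum.reindex_bij_witness[where j = "\<lambda>(b, y). (b div 2, y div 2)" and i = "\<lambda>(b, y). (2 * b, 2 * y)"])
    have "chi3 (2 * z) = - chi3 z" for z by (simp add: chi3_mult) (simp add: chi3_def)
    thus "(case (case t of (b, y) \<Rightarrow> (b div 2, y div 2)) of (b, y) \<Rightarrow> - chi3 y) = (case t of (b, y) \<Rightarrow> chi3 y)"
      if "t \<in> {(b, y). (b, y) \<in> dpairs n \<and> even y \<and> even b}" for t
      using that by (auto elim!: dvdE)
  qed (use True in \<open>auto simp: dpairs_def elim!: dvdE\<close>)
  finally show ?thesis using True by (simp add: R3_def sum_negf case_prod_unfold)
qed

text \<open>The coefficient of \<open>chi4 x\<close> after \<open>rot12_odd1\<close> is added to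
  \<open>rot12_odd2\<close> with its pairs exchanged, apart from a correction at multiples of 3. The
  value 2 comes from \<open>rot12_odd1\<close>, the values 1 and -1 from
  \<open>rot12_odd2\<close>.\<close>

definition two_adic_weight :: "int \<Rightarrow> int \<Rightarrow> int" where
  "two_adic_weight b y = chi3 y * (if even y \<and> even b then 2 else if odd y \<and> even b then 1
     else if even y then (if 4 dvd y then -1 else 1) else 0)"

text \<open>At most one of b and y is even, and then it is not divisible by 4. Moving the factor 2
  from b to y changes the sign of \<open>chi3 y\<close>, because \<open>chi3 2 = -1\<close>, while
  the weight attached to the two positions is the same.\<close>

lemma sum_two_adic_weight:
  assumes "\<not> 4 dvd n"
  shows "(\<Sum>(b, y) \<in> dpairs n. two_adic_weight b y) = 0"
proof -
  let ?A = "{(b, y). (b, y) \<in> dpairs n \<and> odd y \<and> even b}"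
  let ?B = "{(b, y). (b, y) \<in> dpairs n \<and> even y \<and> odd b}"
  have 4: "\<not> (even y \<and> even b)" "\<not> 4 dvd y" "\<not> 4 dvd b" if "(b, y) \<in> dpairs n" for b y
    using that assms mult_dvd_mono[of 2 b 2 y] by (auto simp: dpairs_def)
  have fin: "finite ?A" "finite ?B" by (rule finite_subset[OF _ finite_dpairs[of n]]; auto)+
  have "(\<Sum>(b, y) \<in> dpairs n. two_adic_weight b y) = (\<Sum>(b, y) \<in> ?A \<union> ?B. chi3 y)"
    using 4 by (intro sum.mono_neutral_cong_right finite_dpairs) (auto simp: two_adic_weight_def split: if_splits)
  also have "\<dots> = (\<Sum>(b, y) \<in> ?A. chi3 y) + (\<Sum>(b, y) \<in> ?B. chi3 y)"
    using fin by (intro sum.union_disjoint) auto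
  also have "(\<Sum>(b, y) \<in> ?A. chi3 y) = (\<Sum>(b, y) \<in> ?B. - chi3 y)"
  proof (rule sum.reindex_bij_witness[where j = "\<lambda>(b, y). (b div 2, 2 * y)" and i = "\<lambda>(b, y). (2 * b, y div 2)"])
    have "chi3 (2 * z) = - chi3 z" for z by (simp add: chi3_mult) (simp add: chi3_def)
    thus "(case (case t of (b, y) \<Rightarrow> (b div 2, 2 * y)) of (b, y) \<Rightarrow> - chi3 y) = (case t of (b, y) \<Rightarrow> chi3 y)"
      if "t \<in> ?A" for t using that by auto
  next
    fix t assume t: "t \<in> ?A"
    obtain b y where [simp]: "t = (b, y)" by fastforce
    from t 4(3)[of b y] show "(case t of (b, y) \<Rightarrow> (b div 2, 2 * y)) \<in> ?B"
      by (auto simp: dpairs_def elim!: dvdE)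
  next
    fix t assume t: "t \<in> ?B"
    obtain b y where [simp]: "t = (b, y)" by fastforce
    from t 4(2)[of b y] show "(case t of (b, y) \<Rightarrow> (2 * b, y div 2)) \<in> ?A"
      by (auto simp: dpairs_def elim!: dvdE)
  qed auto
  finally show ?thesis by (simp add: sum_negf case_prod_unfold)
qed

section \<open>Separation of the variables into a convolution\<close>

lemma quads_conv:
  fixes F :: "int \<Rightarrow> int \<Rightarrow> int \<Rightarrow> int \<Rightarrow> int"
  shows "(\<Sum>(a, b, x, y) \<in> quads N. F a b x y) =
    (\<Sum>L \<in> {0<..<N}. \<Sum>(a, x) \<in> dpairs (N - L). \<Sum>(b, y) \<in> dpairs L. F a b x y)"
proof -
  have "(\<Sum>L \<in> {0<..<N}. \<Sum>(a, x) \<in> dpairs (N - L). \<Sum>(b, y) \<in> dpairs L. F a b x y)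
     = (\<Sum>L \<in> {0<..<N}. \<Sum>((a, x), (b, y)) \<in> dpairs (N - L) \<times> dpairs L. F a b x y)"
    by (simp add: sum.cartesian_product case_prod_unfold)
  also have "\<dots> = (\<Sum>(L, (a, x), (b, y)) \<in> (SIGMA L : {0<..<N}. dpairs (N - L) \<times> dpairs L). F a b x y)"
    by (subst sum.Sigma) (auto simp: finite_dpairs case_prod_unfold)
  also have "\<dots> = (\<Sum>(a, b, x, y) \<in> quads N. F a b x y)"
    by (rule sum.reindex_bij_witness[where i = "\<lambda>(a, b, x, y). (b * y, (a, x), (b, y))"
          and j = "\<lambda>(L, (a, x), (b, y)). (a, b, x, y)"])
       (auto simp: quads_def dpairs_def)
  finally show ?thesis by simp
qed

lemma chi4_plus_even: "even x \<Longrightarrow> chi4 (x + y) = (if 4 dvd x then chi4 y else - chi4 y)"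
  unfolding chi4_def by presburger

text \<open>Together with \<open>rot12_odd2\<close> this is the part of \<open>rot12\<close> that is
  odd under (b, y) -> (-b, -y). The two functions collect the terms with
  \<open>chi4 x * chi3 y\<close> and those with \<open>chi4 y * chi3 x\<close>.\<close>

definition rot12_odd1 :: "int \<Rightarrow> int \<Rightarrow> int \<Rightarrow> int \<Rightarrow> int" where
  "rot12_odd1 a b x y = (if even y \<and> even b then chi4 x * chi3 y * (if 3 dvd x then -1 else 2) else 0)"

definition rot12_odd2 :: "int \<Rightarrow> int \<Rightarrow> int \<Rightarrow> int \<Rightarrow> int" where
  "rot12_odd2 a b x y = chi4 y * chi3 x * (if odd x then (if even a then 1 else 0)
     else if even (a + b) then (if 4 dvd x then -1 else 1) else 0)"

lemma rot3_minus_right: "rot3 x (- y) = (if 3 dvd x then chi3 y else chi3 x - 2 * chi3 y)"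
  by (simp add: rot3_def chi3_minus)

lemma chi3_3_dvd: "3 dvd x \<Longrightarrow> chi3 x = 0"
  by (auto simp: chi3_def)

lemma rot12_odd_part: "rot12 a b x y - rot12 a (- b) x (- y) = 2 * (rot12_odd1 a b x y + rot12_odd2 a b x y)"
proof (cases "even x")
  case True
  have "rot4 a b x y = (if even (a + b) then (if 4 dvd x then - chi4 y else chi4 y) else 0)"
    "rot4 a (- b) x (- y) = (if even (a + b) then (if 4 dvd x then chi4 y else - chi4 y) else 0)"
    using True by (auto simp: rot4_def chi4_plus_even chi4_minus chi4_even
        chi4_plus_even[of x "- y", simplified])
  moreover have "rot12_odd1 a b x y = 0" using True by (simp add: rot12_odd1_def chi4_even)
  ultimately show ?thesis using True
    by (simp add: rot12_def rot3_minus_right rot12_odd2_def rot3_def chi3_3_dvd chi3_minus algebra_simps)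
next
  case False
  thus ?thesis
    by (cases "even y") (auto simp: rot12_def rot4_def rot3_minus_right rot3_def rot12_odd1_def rot12_odd2_def chi4_even
        chi4_minus chi3_minus chi3_3_dvd algebra_simps)
qed

text \<open>Up to a constant, the convolution of the representation numbers of 3 (x^2 + y^2) and 4
  (x^2 + x y + y^2). The term L = 0 is left out since b y > 0 for the quadruples; it returns in
  \<open>th_sum_nth\<close>.\<close>

definition char_conv :: "int \<Rightarrow> int" where
  "char_conv N = (\<Sum>L \<in> {L. 0 < L \<and> L < N \<and> 4 dvd L \<and> 3 dvd N - L}. R4 ((N - L) div 3) * R3 (L div 4))"

lemma sum_rot12_odd:
  assumes "N mod 4 = 3"
  shows "(\<Sum>(a, b, x, y) \<in> quads N. rot12_odd1 a b x y + rot12_odd2 b a y x) = - 3 * char_conv N"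
proof -
  let ?c = "\<lambda>x. if 3 dvd x then chi4 x else 0"
  let ?d = "\<lambda>b y. if even y \<and> even b then chi3 y else 0"
  \<comment> \<open>Since N is odd, an even y forces a to be odd, which turns the parity condition
    on a + b into one on b alone. The factor of \<open>rot12_odd1\<close>, 2 or -1 according to 3
    and x, is 2 minus 3 at multiples of 3.\<close>
  have eq: "rot12_odd1 a b x y + rot12_odd2 b a y x = chi4 x * two_adic_weight b y - 3 * (?c x * ?d b y)"
    if "(a, b, x, y) \<in> quads N" for a b x y
  proof -
    have "a * x + b * y = N" using that by (simp add: quads_def)
    moreover have "odd N" using assms by presburger
    ultimately have "odd (a * x + b * y)" by simp
    hence "odd a" if "even y" using that by simp
    thus ?thesis by (cases "even y"; cases "even b") (auto simp: rot12_odd1_def rot12_odd2_def two_adic_weight_def)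
  qed
  have inner: "(\<Sum>(a, x) \<in> dpairs (N - L). \<Sum>(b, y) \<in> dpairs L. chi4 x * two_adic_weight b y - 3 * (?c x * ?d b y))
     = (if 4 dvd L \<and> 3 dvd N - L then - 3 * (R4 ((N - L) div 3) * R3 (L div 4)) else 0)" for L
  proof -
    have "(\<Sum>(a, x) \<in> dpairs (N - L). \<Sum>(b, y) \<in> dpairs L. chi4 x * two_adic_weight b y - 3 * (?c x * ?d b y))
      = R4 (N - L) * (\<Sum>(b, y) \<in> dpairs L. two_adic_weight b y)
        - 3 * ((\<Sum>(a, x) \<in> dpairs (N - L). ?c x) * (\<Sum>(b, y) \<in> dpairs L. ?d b y))"
      unfolding R4_def sum_product by (simp add: sum_subtractf sum_distrib_left case_prod_unfold)
    \<comment> \<open>For every \<open>L\<close> one factor is zero: the first if 4 divides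
      \<open>L\<close>, because then N - L is 3 modulo 4, and the second otherwise.\<close>
    moreover have "R4 (N - L) * (\<Sum>(b, y) \<in> dpairs L. two_adic_weight b y) = 0"
    proof (cases "4 dvd L")
      case True
      hence "(N - L) mod 4 = 3" using assms by presburger
      thus ?thesis by (simp add: R4_3_mod_4)
    qed (simp add: sum_two_adic_weight)
    ultimately show ?thesis by (simp add: sum_chi4_3_dvd sum_chi3_even_even)
  qed
  have "(\<Sum>(a, b, x, y) \<in> quads N. rot12_odd1 a b x y + rot12_odd2 b a y x)
      = (\<Sum>(a, b, x, y) \<in> quads N. chi4 x * two_adic_weight b y - 3 * (?c x * ?d b y))"
    by (intro sum.cong refl) (auto simp: eq)
  also have "\<dots> = (\<Sum>L \<in> {0<..<N}. if 4 dvd L \<and> 3 dvd N - L then - 3 * (R4 ((N - L) div 3) * R3 (L div 4)) else 0)"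
    by (simp only: quads_conv inner)
  also have "\<dots> = (\<Sum>L \<in> {L. 0 < L \<and> L < N \<and> 4 dvd L \<and> 3 dvd N - L}. - 3 * (R4 ((N - L) div 3) * R3 (L div 4)))"
    by (rule sum.mono_neutral_cong_right) (auto split: if_splits)
  also have "\<dots> = - 3 * char_conv N" by (simp add: char_conv_def sum_distrib_left)
  finally show ?thesis .
qed

section \<open>Boundary terms on the two diagonals\<close>

lemma sum_rot3:
  fixes m :: nat
  shows "(\<Sum>j = 1..m. rot3 (2 * int j) (2 * int m + 1 - 2 * int j)) =
    (if 3 dvd 2 * int m + 1 then 1 else - chi3 (2 * int m + 1) * int m)"
proof -
  define G where "G = (\<lambda>r k. \<Sum>j = 1..k. rot3 (2 * int j) (r - 2 * int j))"
  \<comment> \<open>Doubling permutes the residues modulo 3, so three consecutive values of 2 j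
    visit each residue once.\<close>
  have step: "G r (k + 3) = G r k + (rot3 0 r + rot3 1 (r - 1) + rot3 2 (r - 2))" for r k
  proof -
    have "{1..k + 3} = {1..k} \<union> {k + 1, k + 2, k + 3}" by auto
    hence "G r (k + 3) = G r k + (rot3 (2 * int k + 2) (r - (2 * int k + 2))
        + rot3 (2 * int k + 4) (r - (2 * int k + 4)) + rot3 (2 * int k + 6) (r - (2 * int k + 6)))"
      by (simp add: G_def algebra_simps)
    moreover have c: "rot3 x (r - x) = rot3 (x mod 3) (r - x mod 3)" for x
      by (subst (1 2) rot3_mod[symmetric]) (simp add: mod_diff_right_eq)
    have d: "(2 * int k + t) mod 3 = (2 * (int k mod 3) + t) mod 3" for t
      by (metis mod_add_left_eq mod_mult_right_eq)
    have "int k mod 3 = 0 \<or> int k mod 3 = 1 \<or> int k mod 3 = 2" by presburger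
    hence "(2 * int k + 2) mod 3 = 2 \<and> (2 * int k + 4) mod 3 = 1 \<and> (2 * int k + 6) mod 3 = 0 \<or>
      (2 * int k + 2) mod 3 = 1 \<and> (2 * int k + 4) mod 3 = 0 \<and> (2 * int k + 6) mod 3 = 2 \<or>
      (2 * int k + 2) mod 3 = 0 \<and> (2 * int k + 4) mod 3 = 2 \<and> (2 * int k + 6) mod 3 = 1"
      unfolding d by (elim disjE) simp_all
    ultimately show ?thesis
      using c[of "2 * int k + 2"] c[of "2 * int k + 4"] c[of "2 * int k + 6"] by auto
  qed
  have per: "rot3 0 r + rot3 1 (r - 1) + rot3 2 (r - 2) = - 3 * chi3 r" for r
  proof -
    have "rot3 x (r - x) = rot3 x ((r mod 3) - x)" for x
      by (subst (1 2) rot3_mod[symmetric]) (simp add: mod_diff_left_eq)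
    from this[of 0] this[of 1] this[of 2]
    have "rot3 0 r + rot3 1 (r - 1) + rot3 2 (r - 2)
      = rot3 0 (r mod 3) + rot3 1 (r mod 3 - 1) + rot3 2 (r mod 3 - 2)" by simp
    moreover have "r mod 3 = 0 \<or> r mod 3 = 1 \<or> r mod 3 = 2" by presburger
    ultimately show ?thesis by (elim disjE) (simp_all add: rot3_def chi3_def)
  qed
  have rep: "G r (3 * q + k) = G r k - 3 * chi3 r * int q" for r q k
  proof (induction q)
    case (Suc q)
    have "3 * Suc q + k = (3 * q + k) + 3" by simp
    hence "G r (3 * Suc q + k) = G r (3 * q + k) - 3 * chi3 r" by (simp only: step per)
    thus ?case using Suc by (simp add: algebra_simps)
  qed simp
  have res: "G r k = G (r mod 3) k" for r k
    unfolding G_def by (intro sum.cong refl) (subst (1 2) rot3_mod[symmetric], simp add: mod_diff_left_eq)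
  define q k where "q = m div 3" and "k = m mod 3"
  have m: "m = 3 * q + k" by (simp add: q_def k_def)
  \<comment> \<open>Full periods contribute \<open>- 3 * chi3 r\<close> each, so only the remainder
    of m modulo 3 is left. The remainder 1 is exactly the case 3 | 2 m + 1, where the periods
    contribute nothing and the single term 1 survives.\<close>
  have "k = 0 \<or> k = 1 \<or> k = 2" by (auto simp: k_def)
  hence "G (2 * int m + 1) k = (if k = 1 then 1 else - chi3 (2 * int m + 1) * int k)
     \<and> (3 dvd 2 * int m + 1 \<longleftrightarrow> k = 1)"
  proof (elim disjE)
    assume k: "k = 0" thus ?thesis using m by (simp add: G_def; presburger)
  next
    assume k: "k = 1"
    hence r: "(2 * int m + 1) mod 3 = 0" using m by presburger
    have "G 0 1 = rot3 2 (- 2)" by (simp add: G_def)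
    also have "\<dots> = 1" by (simp add: rot3_def chi3_def)
    finally show ?thesis
      using res[of "2 * int m + 1" k, unfolded r] k r by (simp add: dvd_eq_mod_eq_0)
  next
    assume k: "k = 2"
    hence r: "(2 * int m + 1) mod 3 = 2" using m by presburger
    have "{1..2 :: nat} = {1, 2}" by auto
    hence "G 2 2 = rot3 2 0 + rot3 4 (- 2)" by (simp add: G_def)
    also have "\<dots> = 2" by (simp add: rot3_def chi3_def)
    finally show ?thesis
      using res[of "2 * int m + 1" k, unfolded r] k r by (simp add: chi3_def dvd_eq_mod_eq_0)
  qed
  moreover have "G (2 * int m + 1) m = G (2 * int m + 1) k - 3 * chi3 (2 * int m + 1) * int q"
    using rep[of "2 * int m + 1" q k] m by simp
  moreover have "int m = 3 * int q + int k" using m by simp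
  moreover define D where "D = 2 * int m + 1"
  ultimately have "G D m = (if 3 dvd D then 1 else - chi3 D * int m)"
    unfolding D_def[symmetric] by (auto simp: chi3_3_dvd distrib_left)
  thus ?thesis by (simp only: G_def D_def)
qed

lemma boundary_diagonal_left:
  assumes "odd N"
  shows "(\<Sum>(a, b, x, y) | (a, b, x, y) \<in> quads N \<and> a = b. rot12 a b x y) =
    (\<Sum>(a, d) \<in> dpairs N. - chi4 d * (if 3 dvd d then 1 else - chi3 d * ((d - 1) div 2)))"
proof -
  have inner: "(\<Sum>x \<in> {0<..<d}. rot12 a a x (d - x)) =
      - chi4 d * (if 3 dvd d then 1 else - chi3 d * ((d - 1) div 2))"
    if "(a, d) \<in> dpairs N" for a d
  proof -
    have ad: "odd a" "odd d" "d > 0" using that assms by (auto simp: dpairs_def)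
    define m where "m = nat ((d - 1) div 2)"
    have d: "d = 2 * int m + 1" using ad by (auto simp: m_def elim!: oddE)
    \<comment> \<open>Here a and d are odd. For odd x the second entry d - x is even and
      \<open>rot4\<close> asks for an even b, which equals a; so only even x survive, through the
      third branch of \<open>rot4\<close>.\<close>
    have "rot12 a a x (d - x) = (if even x then - chi4 d * rot3 x (d - x) else 0)" for x
      using ad by (auto simp: rot12_def rot4_def)
    hence "(\<Sum>x \<in> {0<..<d}. rot12 a a x (d - x)) = (\<Sum>x \<in> {x. 0 < x \<and> x < d \<and> even x}. - chi4 d * rot3 x (d - x))"
      by (intro sum.mono_neutral_cong_right) auto
    also have "\<dots> = (\<Sum>j = 1..m. - chi4 d * rot3 (2 * int j) (d - 2 * int j))"
      by (rule sum.reindex_bij_witness[where i = "\<lambda>j. 2 * int j" and j = "\<lambda>x. nat (x div 2)"])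
         (auto simp: d elim!: evenE)
    also have "\<dots> = - chi4 d * (\<Sum>j = 1..m. rot3 (2 * int j) (2 * int m + 1 - 2 * int j))"
      by (simp only: d sum_distrib_left)
    also have "\<dots> = - chi4 d * (if 3 dvd d then 1 else - chi3 d * int m)"
      by (simp only: sum_rot3 d)
    also have "int m = (d - 1) div 2" by (simp add: d)
    finally show ?thesis .
  qed
  have "(\<Sum>(a, b, x, y) | (a, b, x, y) \<in> quads N \<and> a = b. rot12 a b x y)
      = (\<Sum>((a, d), x) \<in> (SIGMA p : dpairs N. {0<..<snd p}). rot12 a a x (d - x))"
    by (rule sum.reindex_bij_witness[where i = "\<lambda>((a, d), x). (a, a, x, d - x)"
          and j = "\<lambda>(a, b, x, y). ((a, x + y), x)"])
       (auto simp: quads_def dpairs_def algebra_simps)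
  also have "\<dots> = (\<Sum>(a, d) \<in> dpairs N. \<Sum>x \<in> {0<..<d}. rot12 a a x (d - x))"
    by (subst sum.Sigma[symmetric]) (auto simp: finite_dpairs case_prod_unfold)
  also have "\<dots> = (\<Sum>(a, d) \<in> dpairs N. - chi4 d * (if 3 dvd d then 1 else - chi3 d * ((d - 1) div 2)))"
    by (intro sum.cong refl) (auto simp: inner)
  finally show ?thesis .
qed

lemma boundary_diagonal_right:
  assumes "odd N"
  shows "(\<Sum>(a, b, x, y) | (a, b, x, y) \<in> quads N \<and> x = y. rot12 b (- a) y (- x)) =
    (\<Sum>(e, x) \<in> dpairs N. chi4 x * chi3 x * ((e - 1) div 2))"
proof -
  have inner: "(\<Sum>b \<in> {0<..<e}. rot12 b (b - e) x (- x)) = chi4 x * chi3 x * ((e - 1) div 2)"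
    if "(e, x) \<in> dpairs N" for e x
  proof -
    have ex: "odd e" "odd x" "e > 0" using that assms by (auto simp: dpairs_def)
    \<comment> \<open>Two rotations lead to this point from one whose third entry is x - x = 0,
      where a single branch of \<open>rot4\<close> and of \<open>rot3\<close> applies.\<close>
    have "rot12 b (b - e) x (- x) = (if even b then chi4 x * chi3 x else 0)" for b
      using rot12_rotate1[of "e - b" b x x] ex by (auto simp: rot12_def rot4_def rot3_def)
    hence "(\<Sum>b \<in> {0<..<e}. rot12 b (b - e) x (- x)) = (\<Sum>b \<in> {b. 0 < b \<and> b < e \<and> even b}. chi4 x * chi3 x)"
      by (intro sum.mono_neutral_cong_right) auto
    also have "\<dots> = (\<Sum>j \<in> {0<..(e - 1) div 2}. chi4 x * chi3 x)"
      by (rule sum.reindex_bij_witness[where i = "\<lambda>j. 2 * j" and j = "\<lambda>b. b div 2"])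
         (use ex in \<open>auto elim!: evenE oddE\<close>)
    also have "\<dots> = chi4 x * chi3 x * ((e - 1) div 2)" using ex by simp
    finally show ?thesis .
  qed
  have "(\<Sum>(a, b, x, y) | (a, b, x, y) \<in> quads N \<and> x = y. rot12 b (- a) y (- x))
      = (\<Sum>((e, x), b) \<in> (SIGMA p : dpairs N. {0<..<fst p}). rot12 b (b - e) x (- x))"
    by (rule sum.reindex_bij_witness[where i = "\<lambda>((e, x), b). (e - b, b, x, x)"
          and j = "\<lambda>(a, b, x, y). ((a + b, x), b)"])
       (auto simp: quads_def dpairs_def algebra_simps)
  also have "\<dots> = (\<Sum>(e, x) \<in> dpairs N. \<Sum>b \<in> {0<..<e}. rot12 b (b - e) x (- x))"
    by (subst sum.Sigma[symmetric]) (auto simp: finite_dpairs case_prod_unfold)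
  also have "\<dots> = (\<Sum>(e, x) \<in> dpairs N. chi4 x * chi3 x * ((e - 1) div 2))"
    by (intro sum.cong refl) (auto simp: inner)
  finally show ?thesis .
qed

text \<open>The divisors d prime to 3 on the two diagonals combine into \<open>e - d\<close>. Those
  divisible by 3 occur only on the diagonal a = b and add up to the term with \<open>R4\<close>,
  kept on the left because it is the missing term L = 0 of the convolution.\<close>

theorem char_conv_eq:
  assumes "N mod 4 = 3"
  shows "12 * char_conv N + (if 3 dvd N then 2 * R4 (N div 3) else 0) =
    (\<Sum>(e, d) \<in> dpairs N. chi4 d * chi3 d * (e - d))"
proof -
  have N: "odd N" using assms by presburger
  have swap: "(\<Sum>(a, b, x, y) \<in> quads N. F a b x y) = (\<Sum>(a, b, x, y) \<in> quads N. F b a y x)"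
    for F :: "int \<Rightarrow> int \<Rightarrow> int \<Rightarrow> int \<Rightarrow> int"
    using quads_swap[where P = "\<lambda>_ _ _ _. True" and P' = "\<lambda>_ _ _ _. True" and F = F] by simp
  \<comment> \<open>Exchanging (a, x) with (b, y) in the second sum turns its weight into
    \<open>rot12 a (- b) x (- y)\<close>, so the difference is twice the sum of the odd
    part.\<close>
  have "(\<Sum>(a, b, x, y) \<in> quads N. rot12 a b x y) - (\<Sum>(a, b, x, y) \<in> quads N. rot12 b (- a) y (- x))
     = (\<Sum>(a, b, x, y) \<in> quads N. rot12 a b x y) - (\<Sum>(a, b, x, y) \<in> quads N. rot12 a (- b) x (- y))"
    by (simp add: swap[of "\<lambda>a b x y. rot12 b (- a) y (- x)"])
  also have "\<dots> = (\<Sum>(a, b, x, y) \<in> quads N. 2 * (rot12_odd1 a b x y + rot12_odd2 a b x y))"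
    by (simp add: sum_subtractf[symmetric] case_prod_unfold rot12_odd_part)
  also have "\<dots> = 2 * ((\<Sum>(a, b, x, y) \<in> quads N. rot12_odd1 a b x y) + (\<Sum>(a, b, x, y) \<in> quads N. rot12_odd2 a b x y))"
    by (simp add: sum_distrib_left sum.distrib case_prod_unfold)
  also have "(\<Sum>(a, b, x, y) \<in> quads N. rot12_odd2 a b x y) = (\<Sum>(a, b, x, y) \<in> quads N. rot12_odd2 b a y x)"
    by (rule swap)
  also have "2 * ((\<Sum>(a, b, x, y) \<in> quads N. rot12_odd1 a b x y) + (\<Sum>(a, b, x, y) \<in> quads N. rot12_odd2 b a y x))
     = 2 * (\<Sum>(a, b, x, y) \<in> quads N. rot12_odd1 a b x y + rot12_odd2 b a y x)"
    by (simp add: sum.distrib case_prod_unfold)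
  also have "\<dots> = - 6 * char_conv N" using sum_rot12_odd[OF assms] by simp
  finally have A: "(\<Sum>(a, b, x, y) \<in> quads N. rot12 a b x y) - (\<Sum>(a, b, x, y) \<in> quads N. rot12 b (- a) y (- x))
     = - 6 * char_conv N" .
  have B: "(\<Sum>(a, b, x, y) \<in> quads N. rot12 a b x y) - (\<Sum>(a, b, x, y) \<in> quads N. rot12 b (- a) y (- x)) =
     (\<Sum>(a, d) \<in> dpairs N. - chi4 d * (if 3 dvd d then 1 else - chi3 d * ((d - 1) div 2)))
   - (\<Sum>(e, x) \<in> dpairs N. chi4 x * chi3 x * ((e - 1) div 2))"
    unfolding boundary_diagonal_left[OF N, symmetric] boundary_diagonal_right[OF N, symmetric]
    by (rule liouville_identity) (simp_all add: rot12_rotate1 rot12_rotate2)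
  have "12 * char_conv N = (\<Sum>(e, d) \<in> dpairs N. 2 * (chi4 d * (if 3 dvd d then 1 else - chi3 d * ((d - 1) div 2)))
      + 2 * (chi4 d * chi3 d * ((e - 1) div 2)))"
    using A B unfolding sum.distrib case_prod_unfold sum_distrib_left[symmetric] by (simp add: sum_negf)
  also have "\<dots> = (\<Sum>(e, d) \<in> dpairs N. chi4 d * chi3 d * (e - d) + 2 * (if 3 dvd d then chi4 d else 0))"
  proof (intro sum.cong refl, clarify)
    fix e d assume "(e, d) \<in> dpairs N"
    hence "odd e" "odd d" using N by (auto simp: dpairs_def)
    hence "2 * ((d - 1) div 2) = d - 1" "2 * ((e - 1) div 2) = e - 1" by presburger+
    hence *: "2 * (c * ((d - 1) div 2)) = c * (d - 1)" "2 * (c * ((e - 1) div 2)) = c * (e - 1)" for c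
      by (metis mult.left_commute)+
    show "2 * (chi4 d * (if 3 dvd d then 1 else - chi3 d * ((d - 1) div 2)))
      + 2 * (chi4 d * chi3 d * ((e - 1) div 2)) = chi4 d * chi3 d * (e - d) + 2 * (if 3 dvd d then chi4 d else 0)"
      using *(1)[of "- (chi4 d * chi3 d)"] *(2)[of "chi4 d * chi3 d"]
      by (auto simp: chi3_3_dvd algebra_simps)
  qed
  also have "\<dots> = (\<Sum>(e, d) \<in> dpairs N. chi4 d * chi3 d * (e - d))
      + 2 * (\<Sum>(e, d) \<in> dpairs N. if 3 dvd d then chi4 d else 0)"
    by (simp add: sum.distrib sum_distrib_left case_prod_unfold)
  finally show ?thesis by (simp add: sum_chi4_3_dvd)
qed

section \<open>Representations by the norm forms of the Gaussian and Eisenstein integers\<close>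

text \<open>The norm of x + y omega, where omega^2 = c omega - 1: omega is i for c = 0 and a
  primitive sixth root of unity for c = 1.\<close>

definition qf :: "int \<Rightarrow> int \<Rightarrow> int \<Rightarrow> int" where
  "qf c x y = x\<^sup>2 + c * x * y + y\<^sup>2"

definition qreps :: "int \<Rightarrow> int \<Rightarrow> (int \<times> int) set" where
  "qreps c n = {(x, y). qf c x y = n}"

lemma qf_ge:
  assumes "c = 0 \<or> c = 1"
  shows "x\<^sup>2 + y\<^sup>2 \<le> 2 * qf c x y"
proof -
  have "2 * qf 1 x y - (x\<^sup>2 + y\<^sup>2) = (x + y)\<^sup>2" by (simp add: qf_def power2_eq_square algebra_simps)
  moreover have "(x + y)\<^sup>2 \<ge> 0" by simp
  ultimately have "x\<^sup>2 + y\<^sup>2 \<le> 2 * qf 1 x y" by linarith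
  moreover have "x\<^sup>2 + y\<^sup>2 \<le> 2 * qf 0 x y" by (simp add: qf_def)
  ultimately show ?thesis using assms by auto
qed

lemma abs_le_square_int: "\<bar>x :: int\<bar> \<le> x\<^sup>2"
proof (cases "x = 0")
  case False
  hence "\<bar>x\<bar> * 1 \<le> \<bar>x\<bar> * \<bar>x\<bar>" by (intro mult_left_mono) auto
  thus ?thesis by (simp add: power2_eq_square)
qed simp

lemma finite_qreps:
  assumes "c = 0 \<or> c = 1"
  shows "finite (qreps c n)"
proof (rule finite_subset)
  show "qreps c n \<subseteq> {- 2 * n..2 * n} \<times> {- 2 * n..2 * n}"
  proof
    fix t assume "t \<in> qreps c n"
    then obtain x y where t: "t = (x, y)" and n: "qf c x y = n" by (auto simp: qreps_def)
    show "t \<in> {- 2 * n..2 * n} \<times> {- 2 * n..2 * n}"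
      using qf_ge[OF assms, of x y] abs_le_square_int[of x] abs_le_square_int[of y]
        zero_le_power2[of x] zero_le_power2[of y] unfolding t n
      by (simp del: zero_le_power2) linarith
  qed
qed auto

text \<open>Multiplication by u + v omega, an element of norm p, is a bijection onto its multiples
  of norm p n; the inverse multiplies by the conjugate (u + c v) - v omega and divides by p. The
  condition \<open>p dvd y * u - x * v\<close> tests one coordinate of that product only, since the
  norm forces the other.\<close>

lemma qreps_norm_multiples:
  assumes p: "prime (p :: int)" and uv: "qf c u v = p"
  shows "card {(x, y) \<in> qreps c (p * n). p dvd y * u - x * v} = card (qreps c n)"
proof -
  have p0: "p \<noteq> 0" using p by auto
  have "bij_betw (\<lambda>(x, y). (x * u - y * v, x * v + y * u + c * y * v)) (qreps c n)
      {(x, y) \<in> qreps c (p * n). p dvd y * u - x * v}"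
  proof (rule bij_betw_byWitness[where f' = "\<lambda>(x, y). ((x * (u + c * v) + y * v) div p, (y * u - x * v) div p)"])
    have "((x * u - y * v) * (u + c * v) + (x * v + y * u + c * y * v) * v) = x * p"
      "(x * v + y * u + c * y * v) * u - (x * u - y * v) * v = y * p" for x y
      unfolding uv[symmetric] qf_def by (simp_all add: power2_eq_square algebra_simps)
    thus "\<forall>a\<in>qreps c n. (case case a of (x, y) \<Rightarrow> (x * u - y * v, x * v + y * u + c * y * v) of
        (x, y) \<Rightarrow> ((x * (u + c * v) + y * v) div p, (y * u - x * v) div p)) = a"
      using p0 by auto
    have "qf c (x * u - y * v) (x * v + y * u + c * y * v) = p * qf c x y" for x y
      unfolding uv[symmetric] qf_def by (simp add: power2_eq_square algebra_simps)
    moreover have "(x * v + y * u + c * y * v) * u - (x * u - y * v) * v = p * y" for x y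
      unfolding uv[symmetric] qf_def by (simp add: power2_eq_square algebra_simps)
    ultimately show "(\<lambda>(x, y). (x * u - y * v, x * v + y * u + c * y * v)) ` qreps c n
        \<subseteq> {(x, y) \<in> qreps c (p * n). p dvd y * u - x * v}"
      by (auto simp: qreps_def)
  next
    have *: "\<exists>r s. x * (u + c * v) + y * v = p * r \<and> y * u - x * v = p * s \<and> x = r * u - s * v \<and>
        y = r * v + s * u + c * s * v \<and> qf c r s = n"
      if xy: "qf c x y = p * n" "p dvd y * u - x * v" for x y
    proof -
      define r' where "r' = x * (u + c * v) + y * v"
      from xy(2) obtain s where s: "y * u - x * v = p * s" by (rule dvdE)
      have N: "qf c r' (y * u - x * v) = p * qf c x y"
        unfolding uv[symmetric] qf_def r'_def by (simp add: power2_eq_square algebra_simps)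
      \<comment> \<open>The product with the conjugate has norm p^2 n. As its second coordinate is a
        multiple of p, so is the square of the first.\<close>
      have "p dvd qf c r' (p * s) - p * (s * (c * r' + p * s))"
        unfolding N[unfolded s] by simp
      also have "qf c r' (p * s) - p * (s * (c * r' + p * s)) = r'\<^sup>2"
        by (simp add: qf_def power2_eq_square algebra_simps)
      finally have "p dvd r'" using p by (simp add: prime_dvd_power)
      then obtain r where r: "r' = p * r" by (rule dvdE)
      have "p * (r * u - s * v) = r' * u - (y * u - x * v) * v"
        by (simp only: r s) (simp add: algebra_simps)
      also have "\<dots> = p * x"
        unfolding uv[symmetric] qf_def r'_def by (simp add: power2_eq_square algebra_simps)
      finally have x: "x = r * u - s * v" using p0 by simp
      have "p * (r * v + s * u + c * s * v) = r' * v + (y * u - x * v) * u + c * (y * u - x * v) * v"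
        by (simp only: r s) (simp add: algebra_simps)
      also have "\<dots> = p * y"
        unfolding uv[symmetric] qf_def r'_def by (simp add: power2_eq_square algebra_simps)
      finally have y: "y = r * v + s * u + c * s * v" using p0 by simp
      have "p * qf c r s = qf c x y"
        unfolding uv[symmetric] qf_def x y by (simp add: power2_eq_square algebra_simps)
      hence "qf c r s = n" using xy(1) p0 by simp
      thus ?thesis using r s x y unfolding r'_def by blast
    qed
    show "\<forall>a'\<in>{(x, y) \<in> qreps c (p * n). p dvd y * u - x * v}.
        (case case a' of (x, y) \<Rightarrow> ((x * (u + c * v) + y * v) div p, (y * u - x * v) div p) of
         (x, y) \<Rightarrow> (x * u - y * v, x * v + y * u + c * y * v)) = a'"
    proof (rule ballI)
      fix t assume "t \<in> {(x, y) \<in> qreps c (p * n). p dvd y * u - x * v}"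
      then obtain x y where t: "t = (x, y)" and "qf c x y = p * n" "p dvd y * u - x * v"
        by (auto simp: qreps_def)
      with * obtain r s where rs: "x * (u + c * v) + y * v = p * r" "y * u - x * v = p * s"
        "x = r * u - s * v" "y = r * v + s * u + c * s * v" by blast
      show "(case case t of (x, y) \<Rightarrow> ((x * (u + c * v) + y * v) div p, (y * u - x * v) div p) of
         (x, y) \<Rightarrow> (x * u - y * v, x * v + y * u + c * y * v)) = t"
        unfolding t prod.case rs(1,2) using p0 rs(3,4) by simp
    qed
    show "(\<lambda>(x, y). ((x * (u + c * v) + y * v) div p, (y * u - x * v) div p)) `
        {(x, y) \<in> qreps c (p * n). p dvd y * u - x * v} \<subseteq> qreps c n"
    proof (rule image_subsetI)
      fix t assume "t \<in> {(x, y) \<in> qreps c (p * n). p dvd y * u - x * v}"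
      then obtain x y where t: "t = (x, y)" and "qf c x y = p * n" "p dvd y * u - x * v"
        by (auto simp: qreps_def)
      with * obtain r s where rs: "x * (u + c * v) + y * v = p * r" "y * u - x * v = p * s"
        "qf c r s = n" by blast
      show "(case t of (x, y) \<Rightarrow> ((x * (u + c * v) + y * v) div p, (y * u - x * v) div p)) \<in> qreps c n"
        unfolding t prod.case rs(1,2) using p0 rs(3) by (simp add: qreps_def)
    qed
  qed
  thus ?thesis by (rule bij_betw_same_card[symmetric])
qed

lemma qreps_scale:
  assumes p: "prime (p :: int)"
  shows "card {(x, y) \<in> qreps c (p * n). p dvd x \<and> p dvd y} = (if p dvd n then card (qreps c (n div p)) else 0)"
proof (cases "p dvd n")
  case True
  have p0: "p \<noteq> 0" using p by auto
  have sc: "qf c (p * x) (p * y) = p * (p * qf c x y)" for x y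
    by (simp add: qf_def power2_eq_square algebra_simps)
  from True obtain k where k: "n = p * k" by (rule dvdE)
  have c1: "p * (p * a) = p * n \<longleftrightarrow> a = k" for a using p0 by (simp add: k)
  have "{(x, y) \<in> qreps c (p * n). p dvd x \<and> p dvd y} = (\<lambda>(x, y). (p * x, p * y)) ` qreps c k"
  proof (intro equalityI subsetI)
    fix t assume "t \<in> {(x, y) \<in> qreps c (p * n). p dvd x \<and> p dvd y}"
    then obtain x y where t: "t = (x, y)" "qf c x y = p * n" "p dvd x" "p dvd y" by (auto simp: qreps_def)
    from t(3) obtain x' where x: "x = p * x'" by (rule dvdE)
    from t(4) obtain y' where y: "y = p * y'" by (rule dvdE)
    have "(x', y') \<in> qreps c k" using t(2) unfolding x y sc c1 by (simp add: qreps_def)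
    thus "t \<in> (\<lambda>(x, y). (p * x, p * y)) ` qreps c k" by (rule image_eqI[rotated]) (simp add: t x y)
  qed (auto simp: qreps_def sc k)
  moreover have "inj_on (\<lambda>(x, y). (p * x, p * y)) (qreps c k)" using p0 by (auto simp: inj_on_def)
  ultimately have "card {(x, y) \<in> qreps c (p * n). p dvd x \<and> p dvd y} = card (qreps c k)"
    by (simp only: card_image)
  moreover have "n div p = k" using p0 by (simp add: k)
  ultimately show ?thesis using True by (simp only: if_True)
next
  case False
  have "p dvd n" if "(x, y) \<in> qreps c (p * n)" "p dvd x" "p dvd y" for x y
  proof -
    have "p * p dvd qf c x y" using that(2,3) unfolding qf_def power2_eq_square mult.assoc
      by (intro dvd_add mult_dvd_mono dvd_mult) auto
    hence "p * p dvd p * n" using that(1) by (simp add: qreps_def)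
    thus ?thesis using p by auto
  qed
  hence "{(x, y) \<in> qreps c (p * n). p dvd x \<and> p dvd y} = {}" using False by auto
  thus ?thesis using False by (simp only: card.empty if_False)
qed

text \<open>Inclusion-exclusion: p divides a, or it divides x and contributes \<open>chi p\<close>;
  factorizations where it divides both are counted twice.\<close>

lemma dpairs_prime_rec:
  assumes p: "prime (p :: int)" and mult: "\<And>x y. chi (x * y) = chi x * (chi y :: int)"
  shows "(\<Sum>(a, x) \<in> dpairs (p * n). chi x) =
    (1 + chi p) * (\<Sum>(a, x) \<in> dpairs n. chi x)
    - (if p dvd n then chi p * (\<Sum>(a, x) \<in> dpairs (n div p). chi x) else 0)"
proof -
  let ?A = "{(a, x) \<in> dpairs (p * n). p dvd a}" and ?B = "{(a, x) \<in> dpairs (p * n). p dvd x}"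
  have p0: "p > 0" using p by (simp add: prime_gt_0_int)
  have fin: "finite ?A" "finite ?B" by (rule finite_subset[OF _ finite_dpairs[of "p * n"]]; auto)+
  have un: "dpairs (p * n) = ?A \<union> ?B"
  proof -
    have "p dvd a \<or> p dvd x" if "(a, x) \<in> dpairs (p * n)" for a x
      using that by (intro prime_dvd_multD[OF p]) (simp add: dpairs_def)
    thus ?thesis by auto
  qed
  have c1: "p * a * x = p * m \<longleftrightarrow> a * x = m" and c2: "a * (p * x) = p * m \<longleftrightarrow> a * x = m" for a x m
    using p0 by (simp_all add: mult.assoc mult.left_commute[of a p])
  have pos: "0 < p * x \<longleftrightarrow> 0 < x" for x using p0 by (simp add: zero_less_mult_iff)
  have dv: "p * x div p = x" for x using p0 by simp
  have "?A = (\<lambda>(a, x). (p * a, x)) ` dpairs n"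
  proof (intro equalityI subsetI)
    fix t assume "t \<in> ?A"
    then obtain a x where t: "t = (a, x)" "0 < a" "0 < x" "a * x = p * n" "p dvd a" by (auto simp: dpairs_def)
    from t(5) obtain k where k: "a = p * k" by (rule dvdE)
    have "(k, x) \<in> dpairs n" using t(2-4) unfolding k pos c1 by (simp add: dpairs_def)
    thus "t \<in> (\<lambda>(a, x). (p * a, x)) ` dpairs n" by (rule image_eqI[rotated]) (simp add: t k)
  qed (auto simp: dpairs_def pos c1)
  moreover have "inj_on (\<lambda>(a, x). (p * a, x)) (dpairs n)" using p0 by (auto simp: inj_on_def)
  ultimately have A: "(\<Sum>(a, x) \<in> ?A. chi x) = (\<Sum>(a, x) \<in> dpairs n. chi x)"
    by (simp add: sum.reindex case_prod_unfold)
  have "?B = (\<lambda>(a, x). (a, p * x)) ` dpairs n"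
  proof (intro equalityI subsetI)
    fix t assume "t \<in> ?B"
    then obtain a x where t: "t = (a, x)" "0 < a" "0 < x" "a * x = p * n" "p dvd x" by (auto simp: dpairs_def)
    from t(5) obtain k where k: "x = p * k" by (rule dvdE)
    have "(a, k) \<in> dpairs n" using t(2-4) unfolding k pos c2 by (simp add: dpairs_def)
    thus "t \<in> (\<lambda>(a, x). (a, p * x)) ` dpairs n" by (rule image_eqI[rotated]) (simp add: t k)
  qed (auto simp: dpairs_def pos c2)
  moreover have "inj_on (\<lambda>(a, x). (a, p * x)) (dpairs n)" using p0 by (auto simp: inj_on_def)
  ultimately have B: "(\<Sum>(a, x) \<in> ?B. chi x) = (\<Sum>(a, x) \<in> dpairs n. chi p * chi x)"
    by (simp add: sum.reindex case_prod_unfold mult)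
  have C: "(\<Sum>(a, x) \<in> ?A \<inter> ?B. chi x) =
     (if p dvd n then \<Sum>(a, x) \<in> dpairs (n div p). chi p * chi x else 0)"
  proof (cases "p dvd n")
    case True
    then obtain m where m: "n = p * m" by (rule dvdE)
    have "?A \<inter> ?B = (\<lambda>(a, x). (p * a, p * x)) ` dpairs m"
    proof (intro equalityI subsetI)
      fix t assume "t \<in> ?A \<inter> ?B"
      then obtain a x where t: "t = (a, x)" "0 < a" "0 < x" "a * x = p * n" "p dvd a" "p dvd x"
        by (auto simp: dpairs_def)
      from t(5) obtain k where k: "a = p * k" by (rule dvdE)
      from t(6) obtain l where l: "x = p * l" by (rule dvdE)
      have "(k, l) \<in> dpairs m" using t(2-4) unfolding k l pos c1 m c2 by (simp add: dpairs_def)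
      thus "t \<in> (\<lambda>(a, x). (p * a, p * x)) ` dpairs m" by (rule image_eqI[rotated]) (simp add: t k l)
    qed (auto simp: dpairs_def pos c1 c2 m)
    moreover have "inj_on (\<lambda>(a, x). (p * a, p * x)) (dpairs m)" using p0 by (auto simp: inj_on_def)
    ultimately have "(\<Sum>(a, x) \<in> ?A \<inter> ?B. chi x) = (\<Sum>(a, x) \<in> dpairs m. chi p * chi x)"
      by (simp only: sum.reindex) (simp add: case_prod_unfold mult)
    moreover have "n div p = m" by (simp only: m dv)
    ultimately have "(\<Sum>(a, x) \<in> ?A \<inter> ?B. chi x) = (\<Sum>(a, x) \<in> dpairs (n div p). chi p * chi x)"
      by simp
    thus ?thesis using True by simp
  next
    case False
    have "p dvd n" if "(a, x) \<in> ?A \<inter> ?B" for a x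
    proof -
      have "p * p dvd p * n" using that mult_dvd_mono[of p a p x] by (auto simp: dpairs_def)
      thus ?thesis using p0 by simp
    qed
    hence "?A \<inter> ?B = {}" using False by auto
    thus ?thesis using False by simp
  qed
  have "(\<Sum>(a, x) \<in> ?A \<union> ?B. chi x) + (\<Sum>(a, x) \<in> ?A \<inter> ?B. chi x)
      = (\<Sum>(a, x) \<in> ?A. chi x) + (\<Sum>(a, x) \<in> ?B. chi x)"
    by (rule sum.union_inter[OF fin])
  thus ?thesis unfolding A B C un[symmetric]
    by (cases "p dvd n") (simp_all add: sum_distrib_left[symmetric] case_prod_unfold algebra_simps)
qed

text \<open>The splitting law of primes in the ring generated by omega, with \<open>w\<close> units
  and discriminant c^2 - 4; the ramified prime 2 + c is the norm of 1 + omega. Unique factorization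
  is replaced by a recursion that removes one prime at a time.\<close>

locale norm_form =
  fixes c :: int and chi :: "int \<Rightarrow> int" and w :: int
  assumes c: "c = 0 \<or> c = 1"
    and chi_mult: "\<And>x y. chi (x * y) = chi x * chi y"
    and chi_1: "chi 1 = 1"
    and chi_values: "\<And>x. chi x = 1 \<or> chi x = -1 \<or> chi x = 0"
    and card_units: "int (card (qreps c 1)) = w"
    and split: "\<And>p. prime p \<Longrightarrow> chi p = 1 \<Longrightarrow> (\<exists>u v. qf c u v = p) \<and> \<not> p dvd 4 - c\<^sup>2"
    and inert: "\<And>p x y. prime p \<Longrightarrow> chi p = -1 \<Longrightarrow> p dvd qf c x y \<Longrightarrow> p dvd x \<and> p dvd y"
    and ramified: "\<And>p. prime p \<Longrightarrow> chi p = 0 \<Longrightarrow> p = 2 + c"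
begin

text \<open>Every element of norm p n is divisible by u + v omega or by its conjugate. Divisibility
  by both means divisibility by p: adding the two tests leaves y times the trace 2 u + c v, which is
  prime to p.\<close>

lemma card_qreps_split:
  assumes p: "prime p" "chi p = 1"
  shows "int (card (qreps c (p * n))) =
    2 * int (card (qreps c n)) - (if p dvd n then int (card (qreps c (n div p))) else 0)"
proof -
  obtain u v where uv: "qf c u v = p" and disc: "\<not> p dvd 4 - c\<^sup>2" using split[OF p] by blast
  have uv': "qf c (u + c * v) (- v) = p"
    unfolding uv[symmetric] by (simp add: qf_def power2_eq_square algebra_simps)
  let ?A = "{(x, y) \<in> qreps c (p * n). p dvd y * u - x * v}"
  let ?B = "{(x, y) \<in> qreps c (p * n). p dvd y * (u + c * v) - x * (- v)}"
  have fin: "finite ?A" "finite ?B"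
    by (rule finite_subset[OF _ finite_qreps[OF c, of "p * n"]]; auto)+
  have "p dvd y * u - x * v \<or> p dvd y * (u + c * v) - x * (- v)" if "qf c x y = p * n" for x y
  proof -
    have "(y * u - x * v) * (y * (u + c * v) - x * (- v)) = y\<^sup>2 * qf c u v - v\<^sup>2 * qf c x y"
      by (simp add: qf_def power2_eq_square algebra_simps)
    also have "p dvd \<dots>" unfolding uv that by simp
    finally show ?thesis by (rule prime_dvd_multD[OF p(1)])
  qed
  hence un: "?A \<union> ?B = qreps c (p * n)" by (auto simp: qreps_def)
  have "p dvd x \<and> p dvd y"
    if xy: "qf c x y = p * n" "p dvd y * u - x * v" "p dvd y * (u + c * v) - x * (- v)" for x y
  proof -
    \<comment> \<open>If p divided the trace, it would divide v, as it does not divide the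
      discriminant, and then u; but then p^2 would divide the norm p.\<close>
    have nv: "\<not> p dvd 2 * u + c * v"
    proof
      assume d: "p dvd 2 * u + c * v"
      have "4 * p = (2 * u + c * v)\<^sup>2 + (4 - c\<^sup>2) * v\<^sup>2"
        unfolding uv[symmetric] by (simp add: qf_def power2_eq_square algebra_simps)
      moreover have "p dvd 4 * p - (2 * u + c * v)\<^sup>2"
        using d by (intro dvd_diff) (auto simp: power2_eq_square)
      ultimately have "p dvd (4 - c\<^sup>2) * v\<^sup>2" by simp
      hence v: "p dvd v" using disc p(1) by (meson prime_dvd_multD prime_dvd_power)
      have "u\<^sup>2 = p - v * (c * u + v)"
        unfolding uv[symmetric] by (simp add: qf_def power2_eq_square algebra_simps)
      moreover have "p dvd p - v * (c * u + v)" using v by simp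
      ultimately have u: "p dvd u" using p(1) by (metis prime_dvd_power)
      have "p * p dvd qf c u v" using u v unfolding qf_def power2_eq_square mult.assoc
        by (intro dvd_add mult_dvd_mono dvd_mult) auto
      hence "p * p dvd p * 1" by (simp add: uv)
      thus False using p(1) by (auto dest: not_prime_unit)
    qed
    have "p dvd (y * u - x * v) + (y * (u + c * v) - x * (- v))" using xy by (intro dvd_add)
    also have "\<dots> = y * (2 * u + c * v)" by (simp add: algebra_simps)
    finally have y: "p dvd y" using nv prime_dvd_multD[OF p(1)] by blast
    have "x\<^sup>2 = p * n - y * (c * x + y)"
      unfolding xy(1)[symmetric] by (simp add: qf_def power2_eq_square algebra_simps)
    moreover have "p dvd p * n - y * (c * x + y)" using y by simp
    ultimately have "p dvd x" using p(1) by (metis prime_dvd_power)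
    thus ?thesis using y by simp
  qed
  moreover have "p dvd y * u - x * v" "p dvd y * (u + c * v) - x * (- v)" if "p dvd x" "p dvd y" for x y
    using that by (intro dvd_diff dvd_mult2; simp)+
  ultimately have inter: "?A \<inter> ?B = {(x, y) \<in> qreps c (p * n). p dvd x \<and> p dvd y}"
    by (auto simp: qreps_def)
  have "card ?A + card ?B = card (?A \<union> ?B) + card (?A \<inter> ?B)" by (rule card_Un_Int[OF fin])
  thus ?thesis
    unfolding un inter qreps_scale[OF p(1)] qreps_norm_multiples[OF p(1) uv] qreps_norm_multiples[OF p(1) uv']
    by (cases "p dvd n") simp_all
qed

lemma card_qreps_inert:
  assumes p: "prime p" "chi p = -1"
  shows "card (qreps c (p * n)) = (if p dvd n then card (qreps c (n div p)) else 0)"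
proof -
  have "p dvd x \<and> p dvd y" if "(x, y) \<in> qreps c (p * n)" for x y
    using that by (intro inert[OF p]) (simp add: qreps_def)
  hence eq: "{(x, y) \<in> qreps c (p * n). p dvd x \<and> p dvd y} = qreps c (p * n)" by auto
  show ?thesis using qreps_scale[OF p(1), of c n] unfolding eq .
qed

text \<open>The element 1 + omega has norm p, and modulo p the norm form is the square of y - x, so
  every element of norm p n is a multiple of 1 + omega.\<close>

lemma card_qreps_ramified:
  assumes p: "prime p" "chi p = 0"
  shows "card (qreps c (p * n)) = card (qreps c n)"
proof -
  have pc: "qf c 1 1 = p" using ramified[OF p] by (simp add: qf_def)
  have "p dvd y * 1 - x * 1" if "qf c x y = p * n" for x y
  proof -
    have "(y - x)\<^sup>2 = qf c x y - qf c 1 1 * (x * y)" by (simp add: qf_def power2_eq_square algebra_simps)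
    also have "p dvd \<dots>" unfolding that pc by simp
    finally show ?thesis using p(1) by (simp add: prime_dvd_power)
  qed
  hence eq: "{(x, y) \<in> qreps c (p * n). p dvd y * 1 - x * 1} = qreps c (p * n)"
    by (auto simp: qreps_def)
  show ?thesis using qreps_norm_multiples[OF p(1) pc, of n] unfolding eq .
qed

theorem card_qreps:
  assumes "n > 0"
  shows "int (card (qreps c n)) = w * (\<Sum>(a, x) \<in> dpairs n. chi x)"
  using assms
proof (induction "nat n" arbitrary: n rule: less_induct)
  case less
  show ?case
  proof (cases "n = 1")
    case True
    have "dpairs 1 = {(1, 1)}" by (auto simp: dpairs_def zmult_eq_1_iff)
    thus ?thesis using card_units by (simp add: True chi_1)
  next
    case False
    then obtain p where p: "prime p" "p dvd n"
      using prime_divisor_exists[of n] less.prems by auto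
    then obtain m where m: "n = p * m" by (auto elim: dvdE)
    have p1: "p > 1" using p(1) by (rule prime_gt_1_int)
    hence m0: "m > 0" using less.prems by (simp add: m zero_less_mult_iff)
    have "m < n" using p1 m0 by (simp add: m)
    hence IH1: "int (card (qreps c m)) = w * (\<Sum>(a, x) \<in> dpairs m. chi x)"
      using less.hyps m0 by simp
    have IH2: "int (card (qreps c (m div p))) = w * (\<Sum>(a, x) \<in> dpairs (m div p). chi x)" if "p dvd m"
    proof -
      from that obtain k where k: "m = p * k" by (rule dvdE)
      have "k > 0" "k < n" using k m m0 p1 \<open>m < n\<close>
        by (auto simp: zero_less_mult_iff) (smt (verit) mult_le_cancel_right1 zero_less_mult_iff)
      thus ?thesis using less.hyps[of k] k p1 by simp
    qed
    \<comment> \<open>The split, inert and ramified cases are the values 1, -1 and 0 of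
      \<open>chi p\<close> in a single recursion, the one of
      \<open>dpairs_prime_rec\<close>.\<close>
    have "int (card (qreps c (p * m))) = (1 + chi p) * int (card (qreps c m))
        - (if p dvd m then chi p * int (card (qreps c (m div p))) else 0)"
      using chi_values[of p] card_qreps_split[OF p(1), of m] card_qreps_inert[OF p(1), of m]
        card_qreps_ramified[OF p(1), of m] by auto
    thus ?thesis
      unfolding m dpairs_prime_rec[where chi = chi, OF p(1) chi_mult] using IH1 IH2
      by (cases "p dvd m") (simp_all add: algebra_simps)
  qed
qed

end

section \<open>Which primes are norms\<close>

lemma thue:
  assumes p: "prime (p :: int)"
  shows "\<exists>x y. (x \<noteq> 0 \<or> y \<noteq> 0) \<and> x\<^sup>2 < p \<and> y\<^sup>2 < p \<and> p dvd x - t * y"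
proof -
  have p1: "p > 1" using p by (rule prime_gt_1_int)
  \<comment> \<open>With m^2 > p there are more pairs below m than residues modulo p, so two of them
    collide; minimality of m bounds the squares of their differences by p, strictly since a prime is
    not a square.\<close>
  define m where "m = (LEAST m :: nat. p < (int m)\<^sup>2)"
  have "p < (int (nat p))\<^sup>2" using p1 by (simp add: power2_eq_square)
  hence m: "p < (int m)\<^sup>2" unfolding m_def by (rule LeastI)
  have m0: "m > 0" using m p1 by (cases m) auto
  have "\<not> p < (int (m - 1))\<^sup>2" using not_less_Least[of "m - 1" "\<lambda>m. p < (int m)\<^sup>2"] m0
    by (simp add: m_def[symmetric])
  hence le: "(int m - 1)\<^sup>2 \<le> p" using m0 by (simp add: of_nat_diff)
  have nsq: "z\<^sup>2 \<noteq> p" for z :: int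
    using p prime_power_iff[of z 2] by auto
  let ?f = "\<lambda>(x, y). (x - t * y) mod p"
  let ?S = "{0..<int m} \<times> {0..<int m}"
  have "?f ` ?S \<subseteq> {0..<p}" using p1 by auto
  hence "card (?f ` ?S) \<le> nat p" using card_mono[of "{0..<p}"] by fastforce
  also have "nat p < card ?S" using m p1 by (simp add: power2_eq_square nat_less_iff)
  finally have "\<not> inj_on ?f ?S" by (rule pigeonhole)
  then obtain x1 y1 x2 y2 where xy: "x1 \<in> {0..<int m}" "y1 \<in> {0..<int m}" "x2 \<in> {0..<int m}" "y2 \<in> {0..<int m}"
    "(x1, y1) \<noteq> (x2, y2)" "(x1 - t * y1) mod p = (x2 - t * y2) mod p"
    by (auto simp: inj_on_def)
  have sq: "z\<^sup>2 < p" if "\<bar>z\<bar> \<le> int m - 1" for z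
  proof -
    have "z\<^sup>2 \<le> (int m - 1)\<^sup>2" using that by (metis abs_ge_zero power2_abs power_mono)
    thus ?thesis using le nsq[of z] by linarith
  qed
  have "p dvd (x1 - t * y1) - (x2 - t * y2)" using xy(6) by (simp add: mod_eq_dvd_iff)
  hence "p dvd (x1 - x2) - t * (y1 - y2)" by (simp add: algebra_simps)
  moreover have "(x1 - x2)\<^sup>2 < p" "(y1 - y2)\<^sup>2 < p" using xy by (intro sq; simp; linarith)+
  moreover have "x1 - x2 \<noteq> 0 \<or> y1 - y2 \<noteq> 0" using xy by auto
  ultimately show ?thesis by blast
qed

text \<open>A short vector from \<open>thue\<close> with x = t y (mod p) has norm p k, where k < 2
  for c = 0 and k < 3 for c = 1. The value k = 2 is impossible: x^2 + x y + y^2 is even only if x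
  and y are, and then it is divisible by 4.\<close>

lemma prime_is_norm:
  assumes p: "prime (p :: int)" and c: "c = 0 \<or> c = 1" and p2: "p \<noteq> 2" and t: "p dvd qf c t 1"
  shows "\<exists>u v. qf c u v = p"
proof -
  obtain x y where xy: "x \<noteq> 0 \<or> y \<noteq> 0" "x\<^sup>2 < p" "y\<^sup>2 < p" "p dvd x - t * y" using thue[OF p] by blast
  have "p dvd (x - t * y) * (x + t * y + c * y) + y\<^sup>2 * qf c t 1" using xy(4) t by simp
  also have "\<dots> = qf c x y" by (simp add: qf_def power2_eq_square algebra_simps)
  finally obtain k where k: "qf c x y = p * k" by (rule dvdE)
  have p0: "p > 0" using p by (rule prime_gt_0_int)
  have "x\<^sup>2 + y\<^sup>2 > 0" using xy(1) by (simp add: sum_power2_gt_zero_iff)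
  hence "qf c x y > 0" using qf_ge[OF c, of x y] by linarith
  hence k0: "k > 0" using p0 by (simp add: k zero_less_mult_iff)
  have "2 * (x * y) \<le> x\<^sup>2 + y\<^sup>2" using zero_le_power2[of "x - y"] by (simp add: power2_diff)
  have "p * k < p * 2" if "c = 0" unfolding k[symmetric] using xy that by (simp add: qf_def)
  moreover have "p * k < p * 3" if "c = 1"
    unfolding k[symmetric] using xy that \<open>2 * (x * y) \<le> x\<^sup>2 + y\<^sup>2\<close> by (simp add: qf_def)
  ultimately have "k < 2 \<or> c = 1 \<and> k < 3" using c p0 by auto
  moreover have "k \<noteq> 2" if "c = 1"
  proof
    assume "k = 2"
    hence e: "x\<^sup>2 + x * y + y\<^sup>2 = 2 * p" using k that by (simp add: qf_def)
    hence "even (x\<^sup>2 + x * y + y\<^sup>2)" by simp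
    hence "even x" "even y" by auto
    then obtain a b where "x = 2 * a" "y = 2 * b" by (auto elim!: evenE)
    hence "2 * (a\<^sup>2 + a * b + b\<^sup>2) = p" using e by (simp add: power2_eq_square algebra_simps)
    hence "2 dvd p" by (metis dvd_triv_left)
    thus False using p p2 primes_dvd_imp_eq[of 2 p] by simp
  qed
  ultimately have "k = 1" using k0 by auto
  thus ?thesis using k by auto
qed

text \<open>A power of a primitive root. Order 4 yields a root of t^2 + 1 modulo p and order 3 a
  root of t^2 + t + 1, as \<open>prime_is_norm\<close> requires.\<close>

lemma exists_element_of_order:
  assumes p: "prime (p :: int)" and m: "m > 0" "int m dvd p - 1" and p2: "p \<noteq> 2"
  shows "\<exists>t :: int. p dvd t ^ m - 1 \<and> (\<forall>k. 0 < k \<and> k < m \<longrightarrow> \<not> p dvd t ^ k - 1)"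
proof -
  define q where "q = nat p"
  have p1: "p > 1" using p by (rule prime_gt_1_int)
  hence q: "p = int q" by (simp add: q_def)
  have pq: "prime q" using p by (simp add: q)
  have "odd q" using pq p2 q primes_dvd_imp_eq[OF two_is_prime_nat pq] by auto
  from residue_primroot_odd_prime_power_exists[OF pq this]
  obtain g where "\<forall>k>0. residue_primroot (q ^ k) g" .
  from this[rule_format, of 1] have "residue_primroot q g" by simp
  hence ordg: "ord q g = q - 1" using pq by (simp add: residue_primroot_def totient_prime)
  have "int m dvd int (q - 1)" using m(2) p1 q by (simp add: of_nat_diff)
  hence "m dvd q - 1" by simp
  then obtain s where s: "q - 1 = m * s" by (rule dvdE)
  have s0: "s > 0" using s p1 q by (cases s) auto
  have *: "p dvd int (g ^ s) ^ k - 1 \<longleftrightarrow> m dvd k" for k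
  proof -
    have "p dvd int (g ^ s) ^ k - 1 \<longleftrightarrow> [int (g ^ (s * k)) = int 1] (mod int q)"
      by (simp add: q cong_iff_dvd_diff power_mult)
    also have "\<dots> \<longleftrightarrow> [g ^ (s * k) = 1] (mod q)" by (simp only: cong_int_iff)
    also have "\<dots> \<longleftrightarrow> m * s dvd s * k" by (simp only: ord_divides ordg s)
    also have "\<dots> \<longleftrightarrow> m dvd k" using s0 by (simp add: mult.commute[of m s])
    finally show ?thesis .
  qed
  show ?thesis
    by (rule exI[of _ "int (g ^ s)"]) (auto simp only: * dvd_refl dest: nat_dvd_not_less)
qed

lemma fermat_theorem_int:
  assumes p: "prime (p :: int)" and x: "\<not> p dvd x"
  shows "[x ^ (nat p - 1) = 1] (mod p)"
proof -
  define a where "a = nat (x mod p)"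
  have p0: "p > 0" using p by (rule prime_gt_0_int)
  have a: "int a = x mod p" using p0 by (simp add: a_def)
  have "\<not> nat p dvd a"
  proof
    assume "nat p dvd a"
    hence "int (nat p) dvd int a" by (simp only: int_dvd_int_iff)
    hence "p dvd x mod p" using p0 by (simp add: a)
    thus False using x by (simp add: dvd_mod_iff)
  qed
  moreover have "prime (nat p)" using p p0 by simp
  ultimately have "[a ^ (nat p - 1) = 1] (mod nat p)" by (intro fermat_theorem)
  hence "[int (a ^ (nat p - 1)) = int 1] (mod int (nat p))" by (simp only: cong_int_iff)
  hence "[(x mod p) ^ (nat p - 1) = 1] (mod p)" using p0 by (simp add: a)
  moreover have "[(x mod p) ^ (nat p - 1) = x ^ (nat p - 1)] (mod p)" by (intro cong_pow) simp
  ultimately show ?thesis using cong_trans cong_sym by blast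
qed

text \<open>Otherwise x^2 = -y^2 (mod p) raised to the odd power (p - 1)/2 gives 1 = -1 by
  Fermat.\<close>

lemma prime_3_mod_4_dvd_sum_squares:
  assumes p: "prime (p :: int)" "p mod 4 = 3" and d: "p dvd x\<^sup>2 + y\<^sup>2"
  shows "p dvd x"
proof (rule ccontr)
  assume x: "\<not> p dvd x"
  have y: "\<not> p dvd y"
  proof
    assume "p dvd y"
    hence "p dvd y\<^sup>2" by (simp add: power2_eq_square)
    hence "p dvd x\<^sup>2" using d by (simp add: dvd_add_left_iff)
    thus False using x p(1) by (simp add: prime_dvd_power_iff)
  qed
  define h where "h = 2 * nat (p div 4) + 1"
  have "p > 0" using p(1) by (rule prime_gt_0_int)
  hence "p = int (4 * nat (p div 4) + 3)" using p(2) by (simp; presburger)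
  hence "nat p = 4 * nat (p div 4) + 3" by (metis nat_int)
  hence h: "nat p - 1 = 2 * h" "odd h" by (simp_all add: h_def)
  have "[x\<^sup>2 = - (y\<^sup>2)] (mod p)" using d by (simp add: cong_iff_dvd_diff)
  hence "[(x\<^sup>2) ^ h = (- (y\<^sup>2)) ^ h] (mod p)" by (rule cong_pow)
  moreover have "(- (y\<^sup>2)) ^ h = - ((y\<^sup>2) ^ h)" using h(2) by (rule power_minus_odd)
  ultimately have "[x ^ (nat p - 1) = - (y ^ (nat p - 1))] (mod p)" unfolding h(1) by (simp add: power_mult)
  moreover have "[- (y ^ (nat p - 1)) = - 1] (mod p)"
    using fermat_theorem_int[OF p(1) y] by (simp add: cong_minus_minus_iff)
  ultimately have "[1 = - 1] (mod p)"
    using fermat_theorem_int[OF p(1) x] cong_trans cong_sym by meson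
  hence "p dvd 2" by (simp add: cong_iff_dvd_diff)
  hence "p \<le> 2" by (rule zdvd_imp_le) simp
  moreover have "p > 1" using p(1) by (rule prime_gt_1_int)
  ultimately show False using p(2) by presburger
qed

text \<open>The hypothesis gives x^3 = y^3 (mod p), and as 3 is prime to p - 1, Fermat's theorem
  gives x = y. The form then equals 3 y^2 modulo p.\<close>

lemma prime_2_mod_3_dvd_norm:
  assumes p: "prime (p :: int)" "p mod 3 = 2" and d: "p dvd x\<^sup>2 + x * y + y\<^sup>2"
  shows "p dvd x"
proof (rule ccontr)
  assume x: "\<not> p dvd x"
  have y: "\<not> p dvd y"
  proof
    assume "p dvd y"
    hence "p dvd x * y + y\<^sup>2" by (simp add: power2_eq_square)
    hence "p dvd x\<^sup>2" using d by (metis add.assoc dvd_add_left_iff)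
    thus False using x p(1) by (simp add: prime_dvd_power_iff)
  qed
  have p1: "p > 1" using p(1) by (rule prime_gt_1_int)
  define k where "k = nat (p div 3)"
  have "p = int (3 * k + 2)" using p(2) p1 unfolding k_def by (simp; presburger)
  hence "nat p = 3 * k + 2" by (metis nat_int)
  hence k: "nat p - 1 = 3 * k + 1" by simp
  have "x ^ 3 - y ^ 3 = (x - y) * (x\<^sup>2 + x * y + y\<^sup>2)"
    by (simp add: power2_eq_square power3_eq_cube algebra_simps)
  hence "[x ^ 3 = y ^ 3] (mod p)" using d by (simp add: cong_iff_dvd_diff)
  hence c: "[(x ^ 3) ^ k = (y ^ 3) ^ k] (mod p)" by (rule cong_pow)
  have fx: "[x * (x ^ 3) ^ k = 1] (mod p)" and fy: "[y * (y ^ 3) ^ k = 1] (mod p)"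
    using fermat_theorem_int[OF p(1) x] fermat_theorem_int[OF p(1) y] unfolding k
    by (simp_all add: power_mult)
  have "[y * (x ^ 3) ^ k = y * (y ^ 3) ^ k] (mod p)" using c by (rule cong_scalar_left)
  hence "[x * (x ^ 3) ^ k = y * (x ^ 3) ^ k] (mod p)" using fx fy cong_trans cong_sym by meson
  hence "p dvd (x - y) * (x ^ 3) ^ k" by (simp add: cong_iff_dvd_diff algebra_simps)
  moreover have "\<not> p dvd (x ^ 3) ^ k" using x p(1) by (meson prime_dvd_power)
  ultimately have xy: "p dvd x - y" using p(1) by (meson prime_dvd_multD)
  have "p dvd (x\<^sup>2 + x * y + y\<^sup>2) - (x - y) * (x + 2 * y)" using d xy by simp
  also have "\<dots> = 3 * y\<^sup>2" by (simp add: power2_eq_square algebra_simps)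
  finally have "p dvd 3" using y p(1) by (meson prime_dvd_multD prime_dvd_power)
  hence "p \<le> 3" by (rule zdvd_imp_le) simp
  hence "p = 2" using p1 p(2) by presburger
  thus False using \<open>p dvd 3\<close> by simp
qed

lemma square_eq_1_cases: "x\<^sup>2 + y\<^sup>2 \<le> 2 \<Longrightarrow> (x :: int) \<in> {-1, 0, 1} \<and> y \<in> {-1, 0, 1}"
proof -
  have *: "z \<in> {-1, 0, 1}" if "z\<^sup>2 \<le> 2" for z :: int
  proof -
    have "\<bar>z\<bar> < 2"
    proof (rule ccontr)
      assume "\<not> \<bar>z\<bar> < 2"
      hence "2\<^sup>2 \<le> \<bar>z\<bar>\<^sup>2" by (intro power_mono) auto
      thus False using that by simp
    qed
    thus ?thesis by auto
  qed
  assume "x\<^sup>2 + y\<^sup>2 \<le> 2"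
  thus ?thesis using *[of x] *[of y] zero_le_power2[of x] zero_le_power2[of y] by linarith
qed

lemma qreps_0_1: "qreps 0 1 = {(1, 0), (-1, 0), (0, 1), (0, -1)}"
proof (intro equalityI subsetI)
  fix t assume "t \<in> qreps 0 1"
  then obtain x y where t: "t = (x, y)" "qf 0 x y = 1" by (auto simp: qreps_def)
  have "x \<in> {-1, 0, 1} \<and> y \<in> {-1, 0, 1}" using qf_ge[of 0 x y] t(2) by (intro square_eq_1_cases) simp
  thus "t \<in> {(1, 0), (-1, 0), (0, 1), (0, -1)}" using t by (auto simp: qf_def)
qed (auto simp: qreps_def qf_def)

lemma qreps_1_1: "qreps 1 1 = {(1, 0), (-1, 0), (0, 1), (0, -1), (1, -1), (-1, 1)}"
proof (intro equalityI subsetI)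
  fix t assume "t \<in> qreps 1 1"
  then obtain x y where t: "t = (x, y)" "qf 1 x y = 1" by (auto simp: qreps_def)
  have "x \<in> {-1, 0, 1} \<and> y \<in> {-1, 0, 1}" using qf_ge[of 1 x y] t(2) by (intro square_eq_1_cases) simp
  thus "t \<in> {(1, 0), (-1, 0), (0, 1), (0, -1), (1, -1), (-1, 1)}" using t by (auto simp: qf_def)
qed (auto simp: qreps_def qf_def)

interpretation gauss: norm_form 0 chi4 4
proof
  fix p :: int assume p: "prime p"
  have p1: "p > 1" using p by (rule prime_gt_1_int)
  show "(\<exists>u v. qf 0 u v = p) \<and> \<not> p dvd 4 - 0\<^sup>2" if "chi4 p = 1"
  proof
    have pm: "p mod 4 = 1" using that by (simp add: chi4_def split: if_splits)
    hence p2: "p \<noteq> 2" by auto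
    have "int 4 dvd p - 1" using pm by (simp add: mod_eq_dvd_iff[symmetric])
    then obtain t where t: "p dvd t ^ 4 - 1" "\<not> p dvd t ^ 2 - 1"
      using exists_element_of_order[OF p _ _ p2, of 4] by auto
    have "t ^ 4 - 1 = (t ^ 2 - 1) * (t ^ 2 + 1)" by (simp add: algebra_simps power_add[symmetric])
    hence "p dvd t ^ 2 + 1" using t p by (metis prime_dvd_multD)
    thus "\<exists>u v. qf 0 u v = p" using p p2 by (intro prime_is_norm) (auto simp: qf_def)
    show "\<not> p dvd 4 - 0\<^sup>2"
    proof
      assume "p dvd 4 - 0\<^sup>2"
      hence "p dvd 2 * 2" by simp
      hence "p dvd 2" using p by (meson prime_dvd_multD)
      hence "p \<le> 2" by (rule zdvd_imp_le) simp
      thus False using p1 p2 by simp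
    qed
  qed
  show "p = 2 + 0" if "chi4 p = 0"
  proof -
    have "even p" using that unfolding chi4_def by presburger
    thus ?thesis using primes_dvd_imp_eq[of 2 p] p by simp
  qed
  fix x y assume c: "chi4 p = -1" and d: "p dvd qf 0 x y"
  have pm: "p mod 4 = 3" using c by (simp add: chi4_def split: if_splits)
  show "p dvd x \<and> p dvd y"
    using d prime_3_mod_4_dvd_sum_squares[OF p pm, of x y] prime_3_mod_4_dvd_sum_squares[OF p pm, of y x]
    by (simp add: qf_def add.commute)
qed (auto simp: chi4_mult qreps_0_1, auto simp: chi4_def split: if_splits)

interpretation eisenstein: norm_form 1 chi3 6
proof
  fix p :: int assume p: "prime p"
  have p1: "p > 1" using p by (rule prime_gt_1_int)
  show "(\<exists>u v. qf 1 u v = p) \<and> \<not> p dvd 4 - 1\<^sup>2" if "chi3 p = 1"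
  proof
    have pm: "p mod 3 = 1" using that by (simp add: chi3_def split: if_splits)
    hence p2: "p \<noteq> 2" by auto
    have "int 3 dvd p - 1" using pm by (simp add: mod_eq_dvd_iff[symmetric])
    then obtain t where t: "p dvd t ^ 3 - 1" "\<not> p dvd t ^ 1 - 1"
      using exists_element_of_order[OF p _ _ p2, of 3] by auto
    have "t ^ 3 - 1 = (t ^ 1 - 1) * qf 1 t 1" by (simp add: qf_def algebra_simps power2_eq_square power3_eq_cube)
    hence "p dvd qf 1 t 1" using t p by (metis prime_dvd_multD)
    thus "\<exists>u v. qf 1 u v = p" using p p2 by (intro prime_is_norm) auto
    show "\<not> p dvd 4 - 1\<^sup>2"
    proof
      assume "p dvd 4 - 1\<^sup>2"
      hence "p dvd 3" by simp
      hence "p \<le> 3" by (rule zdvd_imp_le) simp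
      thus False using p1 pm by presburger
    qed
  qed
  show "p = 2 + 1" if "chi3 p = 0"
  proof -
    have "3 dvd p" using that unfolding chi3_def by presburger
    moreover have "prime (3 :: int)" by simp
    ultimately show ?thesis using primes_dvd_imp_eq[of 3 p] p by simp
  qed
  fix x y assume c: "chi3 p = -1" and d: "p dvd qf 1 x y"
  have pm: "p mod 3 = 2" using c by (simp add: chi3_def split: if_splits)
  show "p dvd x \<and> p dvd y"
  proof
    show "p dvd x" using d by (intro prime_2_mod_3_dvd_norm[OF p pm, of x y]) (simp add: qf_def)
    have "qf 1 x y = y\<^sup>2 + y * x + x\<^sup>2" by (simp add: qf_def)
    thus "p dvd y" using d by (intro prime_2_mod_3_dvd_norm[OF p pm, of y x]) simp
  qed
qed (auto simp: chi3_mult qreps_1_1, auto simp: chi3_def split: if_splits)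

lemma card_qreps_0: "n > 0 \<Longrightarrow> int (card (qreps 0 n)) = 4 * R4 n"
  by (simp add: gauss.card_qreps R4_def)

lemma card_qreps_1: "n > 0 \<Longrightarrow> int (card (qreps 1 n)) = 6 * R3 n"
  by (simp add: eisenstein.card_qreps R3_def)

section \<open>Theta series\<close>

text \<open>The formal sum of w(s) q^(N s) over S. A sum over an infinite fibre defaults to 0, so
  \<open>finite_fibres\<close> is demanded wherever fibres are multiplied or split.\<close>

definition gf :: "'a set \<Rightarrow> ('a \<Rightarrow> nat) \<Rightarrow> ('a \<Rightarrow> int) \<Rightarrow> int fps" where
  "gf S N w = Abs_fps (\<lambda>n. \<Sum>s | s \<in> S \<and> N s = n. w s)"

definition finite_fibres :: "'a set \<Rightarrow> ('a \<Rightarrow> nat) \<Rightarrow> bool" where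
  "finite_fibres S N \<longleftrightarrow> (\<forall>n. finite {s. s \<in> S \<and> N s = n})"

lemma gf_nth: "gf S N w $ n = (\<Sum>s | s \<in> S \<and> N s = n. w s)"
  by (simp add: gf_def)

lemma finite_fibresD: "finite_fibres S N \<Longrightarrow> finite {s. s \<in> S \<and> N s = n}"
  by (simp add: finite_fibres_def)

lemma finite_fibres_subset: "finite_fibres S N \<Longrightarrow> T \<subseteq> S \<Longrightarrow> finite_fibres T N"
  unfolding finite_fibres_def by (blast intro: finite_subset[rotated])

lemma finite_fibres_prod:
  assumes "finite_fibres S N" "finite_fibres T M"
  shows "finite_fibres (S \<times> T) (\<lambda>(s, t). N s + M t)"
  unfolding finite_fibres_def
proof
  fix n
  have "{p. p \<in> S \<times> T \<and> (case p of (s, t) \<Rightarrow> N s + M t) = n}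
     \<subseteq> (\<Union>i \<in> {..n}. {s. s \<in> S \<and> N s = i} \<times> {t. t \<in> T \<and> M t = n - i})" by auto
  moreover have "finite \<dots>" using assms by (intro finite_UN_I finite_cartesian_product) (auto dest: finite_fibresD)
  ultimately show "finite {p. p \<in> S \<times> T \<and> (case p of (s, t) \<Rightarrow> N s + M t) = n}" by (rule finite_subset)
qed

lemma gf_mult:
  assumes "finite_fibres S N" "finite_fibres T M"
  shows "gf S N w * gf T M v = gf (S \<times> T) (\<lambda>(s, t). N s + M t) (\<lambda>(s, t). w s * v t)"
proof (rule fps_ext)
  fix n
  let ?A = "\<lambda>i. {s. s \<in> S \<and> N s = i}" and ?B = "\<lambda>i. {t. t \<in> T \<and> M t = i}"
  have fin: "finite (?A i)" "finite (?B i)" for i using assms by (auto dest: finite_fibresD)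
  have "(gf S N w * gf T M v) $ n = (\<Sum>i = 0..n. \<Sum>(s, t) \<in> ?A i \<times> ?B (n - i). w s * v t)"
    by (simp add: fps_mult_nth gf_nth sum_product sum.cartesian_product)
  also have "\<dots> = (\<Sum>(i, s, t) \<in> (SIGMA i : {0..n}. ?A i \<times> ?B (n - i)). w s * v t)"
    using fin by (subst sum.Sigma) (auto simp: case_prod_unfold)
  also have "\<dots> = (\<Sum>(s, t) | (s, t) \<in> S \<times> T \<and> N s + M t = n. w s * v t)"
    by (rule sum.reindex_bij_witness[where i = "\<lambda>(s, t). (N s, s, t)" and j = "\<lambda>(i, s, t). (s, t)"]) auto
  also have "\<dots> = gf (S \<times> T) (\<lambda>(s, t). N s + M t) (\<lambda>(s, t). w s * v t) $ n"
    unfolding gf_nth by (rule sum.cong) auto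
  finally show "(gf S N w * gf T M v) $ n = gf (S \<times> T) (\<lambda>(s, t). N s + M t) (\<lambda>(s, t). w s * v t) $ n" .
qed

lemma gf_reindex:
  assumes "\<And>s. s \<in> S \<Longrightarrow> j s \<in> T" "\<And>t. t \<in> T \<Longrightarrow> i t \<in> S"
    and "\<And>s. s \<in> S \<Longrightarrow> i (j s) = s" "\<And>t. t \<in> T \<Longrightarrow> j (i t) = t"
    and "\<And>s. s \<in> S \<Longrightarrow> M (j s) = N s" "\<And>s. s \<in> S \<Longrightarrow> v (j s) = w s"
  shows "gf S N w = gf T M v"
proof (rule fps_ext)
  fix n
  show "gf S N w $ n = gf T M v $ n" unfolding gf_nth
    by (rule sum.reindex_bij_witness[where i = i and j = j]) (use assms in \<open>auto, metis\<close>)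
qed

lemma gf_cong:
  "S = T \<Longrightarrow> (\<And>s. s \<in> T \<Longrightarrow> N s = M s) \<Longrightarrow> (\<And>s. s \<in> T \<Longrightarrow> w s = v s) \<Longrightarrow> gf S N w = gf T M v"
  by (rule gf_reindex[where i = id and j = id]) auto

lemma gf_union:
  assumes "finite_fibres (S \<union> T) N" "S \<inter> T = {}"
  shows "gf (S \<union> T) N w = gf S N w + gf T N w"
proof (rule fps_ext)
  fix n
  have "{s. s \<in> S \<union> T \<and> N s = n} = {s. s \<in> S \<and> N s = n} \<union> {s. s \<in> T \<and> N s = n}" by auto
  moreover have "finite {s. s \<in> S \<and> N s = n}" "finite {s. s \<in> T \<and> N s = n}"
    by (rule finite_fibresD[OF finite_fibres_subset[OF assms(1)]]; simp)+
  ultimately show "gf (S \<union> T) N w $ n = (gf S N w + gf T N w) $ n"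
    using assms(2) by (simp add: gf_nth) (subst sum.union_disjoint; auto)
qed

lemma gf_add: "gf S N (\<lambda>s. w s + v s) = gf S N w + gf S N v"
  by (rule fps_ext) (simp add: gf_nth sum.distrib)

lemma gf_minus: "gf S N (\<lambda>s. - w s) = - gf S N w"
  by (rule fps_ext) (simp add: gf_nth sum_negf)

lemma gf_antisymmetric:
  assumes "\<And>s. s \<in> S \<Longrightarrow> j s \<in> S" "\<And>s. s \<in> S \<Longrightarrow> j (j s) = s"
    and "\<And>s. s \<in> S \<Longrightarrow> N (j s) = N s" "\<And>s. s \<in> S \<Longrightarrow> w (j s) = - w s"
  shows "gf S N w = 0"
proof -
  have "gf S N w = gf S N (\<lambda>s. - w s)"
    by (rule gf_reindex[where i = j and j = j]) (use assms in auto)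
  hence "gf S N w = - gf S N w" unfolding gf_minus .
  hence "gf S N w $ n = (- gf S N w) $ n" for n by (rule arg_cong)
  thus ?thesis by (intro fps_ext) simp
qed

lemma gf_scale_nth:
  assumes "k > 0"
  shows "gf S (\<lambda>s. k * N s) w $ n = (if k dvd n then gf S N w $ (n div k) else 0)"
proof (cases "k dvd n")
  case True
  then obtain m where m: "n = k * m" by (rule dvdE)
  show ?thesis using assms by (simp add: gf_nth m)
next
  case False
  hence "{s. s \<in> S \<and> k * N s = n} = {}" by auto
  thus ?thesis using False by (simp only: gf_nth sum.empty if_False)
qed

section \<open>Theta series in one variable and their quadratic identities\<close>

definition nsq :: "int \<Rightarrow> nat" where "nsq x = nat (x\<^sup>2)"

lemma int_nsq: "int (nsq x) = x\<^sup>2" by (simp add: nsq_def)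

lemma nsq_minus: "nsq (- x) = nsq x" by (simp add: nsq_def)

lemma finite_fibres_nsq:
  assumes "k > 0"
  shows "finite_fibres S (\<lambda>x. k * nsq x)"
  unfolding finite_fibres_def
proof
  fix n
  have "x \<in> {- int n..int n}" if "k * nsq x = n" for x
  proof -
    have "nsq x \<le> n" using that assms by (cases k) auto
    hence "x\<^sup>2 \<le> int n" using int_nsq[of x] by linarith
    thus ?thesis using abs_le_square_int[of x] by auto
  qed
  hence "{x. x \<in> S \<and> k * nsq x = n} \<subseteq> {- int n..int n}" by auto
  thus "finite {x. x \<in> S \<and> k * nsq x = n}" by (rule finite_subset) simp
qed

definition sg :: "int \<Rightarrow> int" where "sg x = (if 4 dvd x then 1 else -1)"

definition th_even :: "nat \<Rightarrow> int fps" where "th_even k = gf {x. even x} (\<lambda>x. k * nsq x) (\<lambda>_. 1)"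
definition th_odd :: "nat \<Rightarrow> int fps" where "th_odd k = gf {x. odd x} (\<lambda>x. k * nsq x) (\<lambda>_. 1)"
text \<open>Since \<open>sg (2 * m)\<close> is (-1)^m, this is the alternating theta function, the
  sum of (-1)^m q^(4 k m^2) over all m.\<close>

definition th_alt :: "nat \<Rightarrow> int fps" where "th_alt k = gf {x. even x} (\<lambda>x. k * nsq x) sg"
text \<open>Twice Jacobi's series, the sum of (-1)^m (2 m + 1) q^(k (2 m + 1)^2) over m \<ge> 0, as
  x and -x contribute equally.\<close>

definition th_chi :: "nat \<Rightarrow> int fps" where "th_chi k = gf {x. odd x} (\<lambda>x. k * nsq x) (\<lambda>x. chi4 x * x)"

abbreviation pnorm :: "nat \<Rightarrow> nat \<Rightarrow> int \<times> int \<Rightarrow> nat" where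
  "pnorm k l \<equiv> \<lambda>(x, y). k * nsq x + l * nsq y"

lemma finite_fibres_pnorm:
  assumes "k > 0" "l > 0"
  shows "finite_fibres S (pnorm k l)"
  by (rule finite_fibres_subset[OF finite_fibres_prod[OF finite_fibres_nsq[OF assms(1), of UNIV]
        finite_fibres_nsq[OF assms(2), of UNIV]]]) auto

lemma pnorm_eqI:
  assumes "int k * x\<^sup>2 + int l * y\<^sup>2 = int k' * x'\<^sup>2 + int l' * y'\<^sup>2"
  shows "pnorm k l (x, y) = pnorm k' l' (x', y')"
proof -
  have "int (pnorm k l (x, y)) = int (pnorm k' l' (x', y'))" using assms by (simp add: int_nsq)
  thus ?thesis by (simp only: of_nat_eq_iff)
qed

lemma th_mult:
  assumes "k > 0" "l > 0"
  shows "gf S (\<lambda>x. k * nsq x) w * gf T (\<lambda>x. l * nsq x) v = gf (S \<times> T) (pnorm k l) (\<lambda>(x, y). w x * v y)"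
  by (rule gf_mult) (simp_all add: finite_fibres_nsq assms)

lemma half_sum_diff:
  fixes x y :: int
  assumes "even (x + y)"
  shows "x = (x + y) div 2 + (x - y) div 2" "y = (x + y) div 2 - (x - y) div 2"
proof -
  from assms obtain z where "x + y = 2 * z" by (rule evenE)
  hence "y = 2 * z - x" by simp
  thus "x = (x + y) div 2 + (x - y) div 2" "y = (x + y) div 2 - (x - y) div 2" by simp_all
qed

lemma pnorm_half:
  assumes "even (x + y)"
  shows "pnorm (2 * k) (2 * k) ((x + y) div 2, (x - y) div 2) = pnorm k k (x, y)"
proof -
  define s t where "s = (x + y) div 2" and "t = (x - y) div 2"
  have xy: "x = s + t" "y = s - t" using half_sum_diff[OF assms] by (simp_all only: s_def t_def)
  have "pnorm (2 * k) (2 * k) (s, t) = pnorm k k (s + t, s - t)"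
    by (rule pnorm_eqI) (simp add: power2_eq_square algebra_simps)
  thus ?thesis by (simp only: xy[symmetric]) (simp only: s_def t_def)
qed

text \<open>With x = s + t and y = s - t for odd x and y, exactly one of s and t is odd; the second
  summand is the case of odd t with the two names exchanged.\<close>

lemma gf_odd_odd_half:
  assumes k: "k > 0"
  shows "gf ({x. odd x} \<times> {x. odd x}) (pnorm k k) (\<lambda>(x, y). w x y) =
    gf ({x. odd x} \<times> {x. even x}) (pnorm (2 * k) (2 * k)) (\<lambda>(s, t). w (s + t) (s - t)) +
    gf ({x. odd x} \<times> {x. even x}) (pnorm (2 * k) (2 * k)) (\<lambda>(s, t). w (s + t) (t - s))"
proof -
  let ?O = "{x :: int. odd x}" and ?E = "{x :: int. even x}"
  have "gf (?O \<times> ?O) (pnorm k k) (\<lambda>(x, y). w x y)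
    = gf (?O \<times> ?E \<union> ?E \<times> ?O) (pnorm (2 * k) (2 * k)) (\<lambda>(s, t). w (s + t) (s - t))"
  proof (rule gf_reindex[where j = "\<lambda>(x, y). ((x + y) div 2, (x - y) div 2)" and i = "\<lambda>(s, t). (s + t, s - t)"], goal_cases)
    case (1 p)
    then obtain x y where p: "p = (x, y)" "odd x" "odd y" by auto
    thus ?case by (simp; presburger)
  next
    case (3 p)
    then obtain x y where p: "p = (x, y)" "odd x" "odd y" by auto
    thus ?case using half_sum_diff[of x y] by simp
  next
    case (5 p)
    then obtain x y where p: "p = (x, y)" "odd x" "odd y" by auto
    hence "even (x + y)" by simp
    from pnorm_half[OF this, of k] show ?case by (simp only: p prod.case)
  next
    case (6 p)
    then obtain x y where p: "p = (x, y)" "odd x" "odd y" by auto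
    thus ?case using half_sum_diff[of x y, symmetric] by simp
  qed auto
  also have "\<dots> = gf (?O \<times> ?E) (pnorm (2 * k) (2 * k)) (\<lambda>(s, t). w (s + t) (s - t))
      + gf (?E \<times> ?O) (pnorm (2 * k) (2 * k)) (\<lambda>(s, t). w (s + t) (s - t))"
    by (rule gf_union) (use k in \<open>auto intro!: finite_fibres_pnorm\<close>)
  also have "gf (?E \<times> ?O) (pnorm (2 * k) (2 * k)) (\<lambda>(s, t). w (s + t) (s - t))
      = gf (?O \<times> ?E) (pnorm (2 * k) (2 * k)) (\<lambda>(s, t). w (s + t) (t - s))"
    by (rule gf_reindex[where i = "\<lambda>(x, y). (y, x)" and j = "\<lambda>(x, y). (y, x)"]) (auto simp: add.commute)
  finally show ?thesis .
qed

lemma th_odd_square: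
  assumes k: "k > 0"
  shows "th_odd k * th_odd k = 2 * (th_odd (2 * k) * th_even (2 * k))"
proof -
  have "th_odd k * th_odd k = gf ({x. odd x} \<times> {x. odd x}) (pnorm k k) (\<lambda>(x, y). 1)"
    unfolding th_odd_def by (subst th_mult[OF k k]) simp
  moreover have "gf ({x. odd x} \<times> {x. even x}) (pnorm (2 * k) (2 * k)) (\<lambda>(x, y). 1) = th_odd (2 * k) * th_even (2 * k)"
    unfolding th_odd_def th_even_def using k by (subst th_mult) simp_all
  ultimately show ?thesis using gf_odd_odd_half[OF k, of "\<lambda>_ _. 1"] by simp
qed

lemma chi4_odd_plus_even: "odd s \<Longrightarrow> even t \<Longrightarrow> chi4 (s + t) = chi4 s * sg t"
  unfolding chi4_def sg_def by presburger

text \<open>The rotation by 45 degrees behind \<open>th_odd_square\<close>, now with a linear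
  weight: s + t splits into s and t, and the part with t cancels under t -> -t.\<close>

lemma th_chi_times_th_odd:
  assumes k: "k > 0"
  shows "th_chi k * th_odd k = 2 * (th_chi (2 * k) * th_alt (2 * k))"
proof -
  let ?S = "{x :: int. odd x} \<times> {x :: int. even x}"
  have "th_chi k * th_odd k = gf ({x. odd x} \<times> {x. odd x}) (pnorm k k) (\<lambda>(x, y). chi4 x * x)"
    unfolding th_odd_def th_chi_def by (subst th_mult[OF k k]) simp
  also have "\<dots> = 2 * gf ?S (pnorm (2 * k) (2 * k)) (\<lambda>(s, t). chi4 (s + t) * (s + t))"
    by (subst gf_odd_odd_half[OF k, of "\<lambda>x y. chi4 x * x"]) simp
  also have "gf ?S (pnorm (2 * k) (2 * k)) (\<lambda>(s, t). chi4 (s + t) * (s + t))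
    = gf ?S (pnorm (2 * k) (2 * k)) (\<lambda>p. (case p of (s, t) \<Rightarrow> chi4 s * s * sg t) + (case p of (s, t) \<Rightarrow> chi4 s * sg t * t))"
    by (rule gf_cong) (auto simp: chi4_odd_plus_even algebra_simps)
  also have "\<dots> = gf ?S (pnorm (2 * k) (2 * k)) (\<lambda>(s, t). chi4 s * s * sg t)
      + gf ?S (pnorm (2 * k) (2 * k)) (\<lambda>(s, t). chi4 s * sg t * t)"
    by (rule gf_add)
  also have "gf ?S (pnorm (2 * k) (2 * k)) (\<lambda>(s, t). chi4 s * sg t * t) = 0"
    by (rule gf_antisymmetric[where j = "\<lambda>(s, t). (s, - t)"]) (auto simp: nsq_minus sg_def)
  also have "gf ?S (pnorm (2 * k) (2 * k)) (\<lambda>(s, t). chi4 s * s * sg t) = th_chi (2 * k) * th_alt (2 * k)"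
    unfolding th_chi_def th_alt_def using k by (subst th_mult) simp_all
  finally show ?thesis by simp
qed

lemma sg_diff: "even s \<Longrightarrow> even t \<Longrightarrow> sg (s - t) = sg s * sg t"
  unfolding sg_def by presburger

text \<open>If 4 does not divide x + y, exchanging x and y reverses the sign and these pairs cancel.
  On the others x = s + t and y = s - t with s and t even.\<close>

lemma th_even_times_th_alt:
  assumes k: "k > 0"
  shows "th_even k * th_alt k = th_alt (2 * k) * th_alt (2 * k)"
proof -
  let ?E = "{x :: int. even x} \<times> {x :: int. even x}"
  let ?P = "{(x, y). even x \<and> even y \<and> 4 dvd x + y} :: (int \<times> int) set"
  let ?Q = "{(x, y). even x \<and> even y \<and> \<not> 4 dvd x + y} :: (int \<times> int) set"
  have "?E = ?P \<union> ?Q" by auto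
  hence "th_even k * th_alt k = gf (?P \<union> ?Q) (pnorm k k) (\<lambda>(x, y). sg y)"
    unfolding th_even_def th_alt_def by (subst th_mult[OF k k]) simp
  also have "\<dots> = gf ?P (pnorm k k) (\<lambda>(x, y). sg y) + gf ?Q (pnorm k k) (\<lambda>(x, y). sg y)"
    by (rule gf_union) (use k in \<open>auto intro!: finite_fibres_pnorm\<close>)
  also have "gf ?Q (pnorm k k) (\<lambda>(x, y). sg y) = 0"
  proof (rule gf_antisymmetric[where j = "\<lambda>(x, y). (y, x)"], goal_cases)
    case (4 p)
    then obtain x y where p: "p = (x, y)" "even x" "even y" "\<not> 4 dvd x + y" by auto
    hence "4 dvd x \<longleftrightarrow> \<not> 4 dvd y" by presburger
    thus ?case by (simp add: p sg_def)
  qed (auto simp: add.commute)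
  also have "gf ?P (pnorm k k) (\<lambda>(x, y). sg y) = gf ?E (pnorm (2 * k) (2 * k)) (\<lambda>(s, t). sg s * sg t)"
  proof (rule gf_reindex[where j = "\<lambda>(x, y). ((x + y) div 2, (x - y) div 2)" and i = "\<lambda>(s, t). (s + t, s - t)"], goal_cases)
    case (1 p)
    then obtain x y where p: "p = (x, y)" "even x" "even y" "4 dvd x + y" by auto
    thus ?case by (simp; presburger)
  next
    case (2 p)
    then obtain s t where p: "p = (s, t)" "even s" "even t" by auto
    thus ?case by (auto elim!: evenE)
  next
    case (3 p)
    then obtain x y where p: "p = (x, y)" "even x" "even y" by auto
    thus ?case using half_sum_diff[of x y] by simp
  next
    case (5 p)
    then obtain x y where p: "p = (x, y)" "even x" "even y" by auto
    hence "even (x + y)" by simp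
    from pnorm_half[OF this, of k] show ?case by (simp only: p prod.case)
  next
    case (6 p)
    then obtain x y where p: "p = (x, y)" "even x" "even y" "4 dvd x + y" by auto
    hence "even ((x + y) div 2)" "even ((x - y) div 2)" by presburger+
    from sg_diff[OF this] show ?case using half_sum_diff(2)[of x y, symmetric] p by simp
  qed auto
  also have "\<dots> = th_alt (2 * k) * th_alt (2 * k)"
    unfolding th_alt_def using k by (subst th_mult) simp_all
  finally show ?thesis by simp
qed

text \<open>Legendre's modular equation of degree 3. The odd pairs fall into two classes
  \<open>?U\<close> and \<open>?V\<close> of equal size, and a hexagonal reflection identifies
  \<open>?U\<close> with the even pairs \<open>?Q\<close> of sign -1. So the left side is P + Q - 2
  Q, which is the signed sum over all even pairs.\<close>

lemma th_hexagonal: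
  assumes k: "k > 0"
  shows "th_even k * th_even (3 * k) - th_odd k * th_odd (3 * k) = th_alt k * th_alt (3 * k)"
proof -
  let ?E = "{x :: int. even x} \<times> {x :: int. even x}"
  let ?P = "{(x, y). even x \<and> even y \<and> 4 dvd x + y} :: (int \<times> int) set"
  let ?Q = "{(x, y). even x \<and> even y \<and> \<not> 4 dvd x + y} :: (int \<times> int) set"
  let ?U = "{(x, y). odd x \<and> odd y \<and> 4 dvd x - y} :: (int \<times> int) set"
  let ?V = "{(x, y). odd x \<and> odd y \<and> 4 dvd x + y} :: (int \<times> int) set"
  let ?g = "\<lambda>S. gf S (pnorm k (3 * k)) (\<lambda>(x, y). 1)"
  have fin: "finite_fibres S (pnorm k (3 * k))" for S using k by (intro finite_fibres_pnorm) auto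
  have E: "?E = ?P \<union> ?Q" by auto
  have O: "{x :: int. odd x} \<times> {x :: int. odd x} = ?U \<union> ?V" by auto presburger
  have "th_even k * th_even (3 * k) = gf ?E (pnorm k (3 * k)) (\<lambda>(x, y). 1)"
    unfolding th_even_def using k by (subst th_mult) simp_all
  also have "\<dots> = ?g ?P + ?g ?Q" unfolding E by (rule gf_union[OF fin]) auto
  finally have ee: "th_even k * th_even (3 * k) = ?g ?P + ?g ?Q" .
  have "th_odd k * th_odd (3 * k) = gf ({x. odd x} \<times> {x. odd x}) (pnorm k (3 * k)) (\<lambda>(x, y). 1)"
    unfolding th_odd_def using k by (subst th_mult) simp_all
  also have "\<dots> = ?g ?U + ?g ?V"
    unfolding O by (rule gf_union[OF fin]) (auto; presburger)
  finally have oo: "th_odd k * th_odd (3 * k) = ?g ?U + ?g ?V" .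
  have "th_alt k * th_alt (3 * k) = gf ?E (pnorm k (3 * k)) (\<lambda>(x, y). sg x * sg y)"
    unfolding th_alt_def using k by (subst th_mult) simp_all
  also have "\<dots> = gf ?P (pnorm k (3 * k)) (\<lambda>(x, y). sg x * sg y) + gf ?Q (pnorm k (3 * k)) (\<lambda>(x, y). sg x * sg y)"
    unfolding E by (rule gf_union[OF fin]) auto
  also have "gf ?P (pnorm k (3 * k)) (\<lambda>(x, y). sg x * sg y) = ?g ?P"
  proof (rule gf_cong, goal_cases)
    case (3 p)
    then obtain x y where p: "p = (x, y)" "even x" "even y" "4 dvd x + y" by auto
    hence "4 dvd x \<longleftrightarrow> 4 dvd y" by presburger
    thus ?case by (simp add: p sg_def)
  qed auto
  also have "gf ?Q (pnorm k (3 * k)) (\<lambda>(x, y). sg x * sg y) = gf ?Q (pnorm k (3 * k)) (\<lambda>p. - (case p of (x, y) \<Rightarrow> 1))"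
  proof (rule gf_cong, goal_cases)
    case (3 p)
    then obtain x y where p: "p = (x, y)" "even x" "even y" "\<not> 4 dvd x + y" by auto
    hence "4 dvd x \<longleftrightarrow> \<not> 4 dvd y" by presburger
    thus ?case by (simp add: p sg_def)
  qed auto
  also have "\<dots> = - ?g ?Q" by (rule gf_minus)
  finally have aa: "th_alt k * th_alt (3 * k) = ?g ?P - ?g ?Q" by (simp add: case_prod_unfold)
  have UV: "?g ?U = ?g ?V"
    by (rule gf_reindex[where i = "\<lambda>(x, y). (x, - y)" and j = "\<lambda>(x, y). (x, - y)"]) (auto simp: nsq_minus)
  \<comment> \<open>The map is an involution that preserves x^2 + 3 y^2, a reflection of the
    hexagonal lattice; hence the same function serves in both directions.\<close>
  have UQ: "?g ?U = ?g ?Q"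
  proof (rule gf_reindex[where i = "\<lambda>(x, y). ((x + 3 * y) div 2, (x - y) div 2)"
        and j = "\<lambda>(x, y). ((x + 3 * y) div 2, (x - y) div 2)"], goal_cases)
    case (1 p)
    then obtain x y where p: "p = (x, y)" "odd x" "odd y" "4 dvd x - y" by auto
    then obtain z where z: "x - y = 4 * z" by (auto elim: dvdE)
    have "(x + 3 * y) div 2 = 2 * (y + z)" "(x - y) div 2 = 2 * z" using z by presburger+
    thus ?case using p by (simp; presburger)
  next
    case (2 p)
    then obtain x y where p: "p = (x, y)" "even x" "even y" "\<not> 4 dvd x + y" by auto
    then obtain a b where ab: "x = 2 * a" "y = 2 * b" by (auto elim!: evenE)
    have "odd (a + b)" using p(4) unfolding ab by presburger
    moreover have "(x + 3 * y) div 2 = a + 3 * b" "(x - y) div 2 = a - b" using ab by simp_all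
    ultimately show ?case using p by simp
  next
    case (3 p)
    then obtain x y where p: "p = (x, y)" "odd x" "odd y" by auto
    then obtain z where "x = y + 2 * z" by (auto elim!: oddE intro: that[of "(x - y) div 2"])
    thus ?case by (simp add: p)
  next
    case (4 p)
    then obtain x y where p: "p = (x, y)" "even x" "even y" by auto
    then obtain z where "x = y + 2 * z" by (auto elim!: evenE intro: that[of "(x - y) div 2"])
    thus ?case by (simp add: p)
  next
    case (5 p)
    then obtain x y where p: "p = (x, y)" "odd x" "odd y" by auto
    then obtain z where x: "x = y + 2 * z" by (auto elim!: oddE intro: that[of "(x - y) div 2"])
    have "(x + 3 * y) div 2 = 2 * y + z" "(x - y) div 2 = z" by (simp_all add: x)
    moreover have "pnorm k (3 * k) (2 * y + z, z) = pnorm k (3 * k) (x, y)"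
      by (rule pnorm_eqI) (simp add: x power2_eq_square algebra_simps)
    ultimately show ?case by (simp only: p prod.case)
  qed auto
  show ?thesis unfolding ee oo aa UV[symmetric] UQ by simp
qed

text \<open>
  Both sides satisfy the same relation between the series in \<open>q\<close> and in \<open>q\<^sup>2\<close>, so the order
  of their difference at \<open>q = 0\<close> would have to double; this is Jacobi's identity for the cube of
  Euler's product, without products.
\<close>

lemma th_chi_product:
  assumes k: "k > 0"
  shows "th_odd k * (th_alt (2 * k) * th_alt (2 * k)) = th_chi k"
proof -
  define P where "P = (\<lambda>k. th_odd k * (th_alt (2 * k) * th_alt (2 * k)))"
  define D where "D = (\<lambda>k. th_chi k - P k)"
  define T where "T = {x :: int. odd x} \<times> {x :: int. even x} \<times> {x :: int. even x}"
  define N where "N = (\<lambda>(x, y, z). nsq x + (2 * nsq y + 2 * nsq z))"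
  define W where "W = (\<lambda>(x :: int, y, z). sg y * sg z)"
  have PT: "P k = gf T (\<lambda>t. k * N t) W" if "k > 0" for k
  proof -
    have "P k = gf {x. odd x} (\<lambda>x. k * nsq x) (\<lambda>_. 1) *
        gf ({x. even x} \<times> {x. even x}) (pnorm (2 * k) (2 * k)) (\<lambda>(x, y). sg x * sg y)"
      unfolding P_def th_odd_def th_alt_def using that by (subst th_mult) simp_all
    also have "\<dots> = gf T (\<lambda>(s, t). k * nsq s + pnorm (2 * k) (2 * k) t) (\<lambda>(s, t). 1 * (case t of (x, y) \<Rightarrow> sg x * sg y))"
      unfolding T_def using that by (intro gf_mult finite_fibres_nsq finite_fibres_pnorm) auto
    also have "\<dots> = gf T (\<lambda>t. k * N t) W"
      by (rule gf_cong) (auto simp: N_def W_def algebra_simps)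
    finally show ?thesis .
  qed
  have scale: "D k $ n = (if k dvd n then D 1 $ (n div k) else 0)" if "k > 0" for k n
  proof -
    have "P k $ n = (if k dvd n then P 1 $ (n div k) else 0)"
      unfolding PT[OF that] gf_scale_nth[OF that] using PT[of 1] by simp
    moreover have "th_chi k $ n = (if k dvd n then th_chi 1 $ (n div k) else 0)"
      unfolding th_chi_def gf_scale_nth[OF that] by simp
    ultimately show ?thesis by (simp add: D_def)
  qed
  \<comment> \<open>The relation of \<open>th_chi_times_th_odd\<close> is linear in the series, so
    once \<open>P\<close> satisfies it too, it passes to the difference.\<close>
  have rec: "D 1 * th_odd 1 = 2 * (D 2 * th_alt 2)"
  proof -
    have "P 1 * th_odd 1 = (th_odd 1 * th_odd 1) * (th_alt 2 * th_alt 2)"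
      by (simp add: P_def algebra_simps del: One_nat_def)
    also have "\<dots> = 2 * (th_odd 2 * (th_even 2 * th_alt 2) * th_alt 2)"
      using th_odd_square[of 1] by (simp add: algebra_simps del: One_nat_def)
    also have "\<dots> = 2 * (P 2 * th_alt 2)" using th_even_times_th_alt[of 2] by (simp add: P_def)
    finally show ?thesis using th_chi_times_th_odd[of 1]
      by (simp add: D_def algebra_simps del: One_nat_def)
  qed
  have nsq0: "{x. odd x \<and> nsq x = 0} = {}" by (auto simp: nsq_def)
  have nsq1: "{x. odd x \<and> nsq x = Suc 0} = {1, -1}"
    by (auto simp: nsq_def power2_eq_1_iff nat_eq_iff)
  have even0: "{x. even x \<and> 2 * nsq x = 0} = {0}" by (auto simp: nsq_def)
  have odd0: "th_odd 1 $ 0 = 0" and odd1: "th_odd 1 $ 1 = 2"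
    by (simp_all add: th_odd_def gf_nth nsq0 nsq1)
  have chi0: "th_chi 1 $ 0 = 0" and chi1: "th_chi 1 $ 1 = 2"
    by (simp_all add: th_chi_def gf_nth nsq0 nsq1 chi4_def)
  have alt0: "th_alt 2 $ 0 = 1" using even0 by (simp add: th_alt_def gf_nth sg_def)
  have D0: "D 1 $ 0 = 0" using chi0 odd0 by (simp add: D_def P_def)
  \<comment> \<open>The coefficients at 0 and 1 are computed directly, since the induction below
    needs (n + 1) div 2 < n, that is n \<ge> 2.\<close>
  have D1: "D 1 $ 1 = 0" using odd0 odd1 alt0 chi1
    by (simp add: D_def P_def fps_mult_nth)
  have "D 1 $ n = 0" for n
  proof (induction n rule: less_induct)
    case (less n)
    show ?case
    proof (cases "n \<le> 1")
      case True
      thus ?thesis using D0 D1 by (cases n) auto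
    next
      case False
      \<comment> \<open>The series \<open>th_odd 1\<close> begins with 2 q, so the coefficient at n
        + 1 isolates 2 D(n) once all earlier ones vanish. On the other side \<open>D 2\<close> is
        \<open>D 1\<close> in q^2 and involves only indices below n.\<close>
      have "(D 1 * th_odd 1) $ (n + 1) = (\<Sum>i = 0..n + 1. D 1 $ i * th_odd 1 $ (n + 1 - i))"
        by (simp add: fps_mult_nth)
      also have "\<dots> = (\<Sum>i \<in> {n}. D 1 $ i * th_odd 1 $ (n + 1 - i))"
      proof (rule sum.mono_neutral_right)
        show "\<forall>i\<in>{0..n + 1} - {n}. D 1 $ i * th_odd 1 $ (n + 1 - i) = 0"
        proof
          fix i assume "i \<in> {0..n + 1} - {n}"
          hence "i < n \<or> i = n + 1" by auto
          thus "D 1 $ i * th_odd 1 $ (n + 1 - i) = 0" using less odd0 by auto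
        qed
      qed auto
      also have "\<dots> = 2 * D 1 $ n" using odd1 by simp
      finally have "2 * D 1 $ n = (2 * (D 2 * th_alt 2)) $ (n + 1)" by (simp only: rec)
      also have "\<dots> = 2 * (\<Sum>i = 0..n + 1. D 2 $ i * th_alt 2 $ (n + 1 - i))"
        by (simp only: mult_2 fps_add_nth fps_mult_nth)
      also have "(\<Sum>i = 0..n + 1. D 2 $ i * th_alt 2 $ (n + 1 - i)) = 0"
      proof (rule sum.neutral, rule ballI)
        fix i assume "i \<in> {0..n + 1}"
        hence "i div 2 < n" using False by auto
        hence "D 2 $ i = 0" using less.IH[of "i div 2"] scale[of 2 i] by simp
        thus "D 2 $ i * th_alt 2 $ (n + 1 - i) = 0" by simp
      qed
      finally show ?thesis by simp
    qed
  qed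
  hence "D k = 0" by (intro fps_ext) (simp add: scale[OF k])
  thus ?thesis by (simp add: D_def P_def)
qed

lemma th_difference:
  "th_odd 3 * th_even 3 * (th_odd 1 * th_odd 3 - th_even 1 * th_even 3) = - (th_chi 3 * th_alt 1)"
proof -
  have "th_odd 3 * th_even 3 * (th_odd 1 * th_odd 3 - th_even 1 * th_even 3)
     = - (th_odd 3 * th_even 3 * (th_alt 1 * th_alt 3))"
    using th_hexagonal[of 1] by (simp add: algebra_simps)
  also have "\<dots> = - (th_odd 3 * (th_even 3 * th_alt 3) * th_alt 1)" by (simp add: algebra_simps)
  also have "\<dots> = - (th_chi 3 * th_alt 1)"
    using th_even_times_th_alt[of 3] th_chi_product[of 3] by simp
  finally show ?thesis .
qed

section \<open>The Kronecker symbol and divisor sums\<close>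

lemma square_mod_8:
  fixes x :: int
  shows "odd x \<Longrightarrow> x\<^sup>2 mod 8 = 1" "x mod 4 = 2 \<Longrightarrow> x\<^sup>2 mod 8 = 4" "4 dvd x \<Longrightarrow> x\<^sup>2 mod 8 = 0"
proof -
  define r where "r = x mod 8"
  have *: "x\<^sup>2 mod 8 = r\<^sup>2 mod 8" by (simp add: r_def power_mod)
  have r: "r \<in> {0,1,2,3,4,5,6,7}" unfolding r_def by auto
  have "odd x \<longleftrightarrow> odd r" "x mod 4 = r mod 4" "4 dvd x \<longleftrightarrow> 4 dvd r"
    by (simp_all add: r_def dvd_mod_iff mod_mod_cancel)
  thus "odd x \<Longrightarrow> x\<^sup>2 mod 8 = 1" "x mod 4 = 2 \<Longrightarrow> x\<^sup>2 mod 8 = 4" "4 dvd x \<Longrightarrow> x\<^sup>2 mod 8 = 0"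
    unfolding * using r by auto
qed

lemma Legendre_3_right: "Legendre a 3 = chi3 a"
proof -
  have m: "a mod 3 = 0 \<or> a mod 3 = 1 \<or> a mod 3 = 2" by presburger
  have sq: "y\<^sup>2 mod 3 \<noteq> 2" for y :: int
  proof -
    define r where "r = y mod 3"
    have "y\<^sup>2 mod 3 = r\<^sup>2 mod 3" by (simp add: r_def power_mod)
    moreover have "r \<in> {0,1,2}" unfolding r_def by auto
    ultimately show ?thesis by auto
  qed
  have "QuadRes 3 a" if "a mod 3 = 1"
    unfolding QuadRes_def by (rule exI[of _ 1]) (simp add: cong_def that)
  moreover have "\<not> QuadRes 3 a" if "a mod 3 = 2"
    using sq that by (auto simp: QuadRes_def cong_def)
  ultimately show ?thesis using m by (auto simp: Legendre_def chi3_def cong_def)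
qed

text \<open>Quadratic reciprocity with (3 - 1)/2 = 1: the sign is (-1)^((p - 1)/2), which is
  \<open>chi4 p\<close>. At p = 3 both sides are 0.\<close>

lemma Legendre_3_left:
  assumes p: "prime (p :: int)" "odd p"
  shows "Legendre 3 p = chi4 p * chi3 p"
proof (cases "p = 3")
  case True
  thus ?thesis by (simp add: Legendre_def chi3_def cong_def)
next
  case False
  have "p > 1" using p(1) by (rule prime_gt_1_int)
  moreover have "p \<noteq> 2" using p(2) by auto
  ultimately have p2: "p > 2" by simp
  have "prime (nat p)" using p(1) p2 by simp
  moreover have "prime (nat 3)" by simp
  ultimately have "Legendre 3 p * Legendre p 3 = (-1) ^ nat ((3 - 1) div 2 * ((p - 1) div 2))"
    using p2 False by (intro Quadratic_Reciprocity_int) auto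
  also have "(3 - 1) div 2 * ((p - 1) div 2) = (p - 1) div 2" by simp
  also have "(-1) ^ nat ((p - 1) div 2) = chi4 p"
  proof -
    have "p mod 4 = 1 \<or> p mod 4 = 3" using p(2) by presburger
    thus ?thesis
    proof
      assume m: "p mod 4 = 1"
      hence "even ((p - 1) div 2)" by presburger
      hence "even (nat ((p - 1) div 2))" using p2 by (simp add: even_nat_iff)
      thus ?thesis using m by (simp add: chi4_def)
    next
      assume m: "p mod 4 = 3"
      hence "odd ((p - 1) div 2)" by presburger
      hence "odd (nat ((p - 1) div 2))" using p2 by (simp add: even_nat_iff)
      thus ?thesis using m by (simp add: chi4_def)
    qed
  qed
  finally have *: "Legendre 3 p * chi3 p = chi4 p" by (simp add: Legendre_3_right)
  have "\<not> 3 dvd p" using p(1) False primes_dvd_imp_eq[of 3 p] by auto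
  hence "chi3 p * chi3 p = 1" unfolding chi3_def by (auto; presburger)
  thus ?thesis using * by (metis mult.assoc mult.right_neutral)
qed

definition chi12 :: "int \<Rightarrow> int" where "chi12 d = chi4 d * chi3 d"

lemma chi12_mult: "chi12 (x * y) = chi12 x * chi12 y"
  by (simp add: chi12_def chi4_mult chi3_mult)

lemma chi12_1: "chi12 1 = 1"
  by (simp add: chi12_def chi4_def chi3_def)

lemma chi12_power: "chi12 (x ^ k) = chi12 x ^ k"
  by (induction k) (simp_all add: chi12_mult chi12_1)

lemma chi12_prod: "finite A \<Longrightarrow> chi12 (prod f A) = (\<Prod>a\<in>A. chi12 (f a))"
  by (induction A rule: finite_induct) (simp_all add: chi12_mult chi12_1)

text \<open>Both sides are completely multiplicative and agree at odd primes. Oddness matters: at 2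
  the symbol is -1 while \<open>chi12\<close> vanishes.\<close>

lemma kronecker_3:
  assumes "m > 0" "odd m"
  shows "kronecker 3 m = chi12 m"
proof -
  have "kronecker_prime 3 p = chi12 p" if "p \<in> prime_factors m" for p
  proof -
    have "prime p" "p dvd m" using that by auto
    hence "odd p" using assms(2) by (meson dvd_trans)
    thus ?thesis using Legendre_3_left[OF \<open>prime p\<close>] by (auto simp: kronecker_prime_def chi12_def)
  qed
  hence "kronecker 3 m = (\<Prod>p\<in>prime_factors m. chi12 (p ^ multiplicity p m))"
    using assms by (simp add: kronecker_def chi12_power)
  also have "\<dots> = chi12 (\<Prod>p\<in>prime_factors m. p ^ multiplicity p m)"
    by (simp add: chi12_prod)
  also have "(\<Prod>p\<in>prime_factors m. p ^ multiplicity p m) = m"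
    using assms by (simp add: prod_prime_factors)
  finally show ?thesis .
qed

lemma chi12_square:
  assumes "odd d" "\<not> 3 dvd d"
  shows "chi12 d * chi12 d = 1"
proof -
  have "chi4 d = 1 \<or> chi4 d = -1" using assms(1) unfolding chi4_def by presburger
  moreover have "chi3 d = 1 \<or> chi3 d = -1" using assms(2) unfolding chi3_def by presburger
  ultimately show ?thesis by (auto simp: chi12_def)
qed

lemma sum_dpairs_divisors:
  assumes "m > 0"
  shows "(\<Sum>(e, d) \<in> dpairs (int m). F e d) = (\<Sum>d | d dvd m. F (int (m div d)) (int d))"
proof (rule sum.reindex_bij_witness[where i = "\<lambda>d. (int (m div d), int d)" and j = "\<lambda>(e, d). nat d"])
  fix t assume "t \<in> dpairs (int m)"
  then obtain e d where t: "t = (e, d)" "0 < e" "0 < d" "e * d = int m" by (auto simp: dpairs_def)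
  obtain e' d' where ed: "e = int e'" "d = int d'" using t(2,3) by (metis less_imp_le zero_le_imp_eq_int)
  have m: "m = e' * d'" using t(4) unfolding ed by (metis of_nat_eq_iff of_nat_mult)
  show "(int (m div (case t of (e, d) \<Rightarrow> nat d)), int (case t of (e, d) \<Rightarrow> nat d)) = t"
    "(case t of (e, d) \<Rightarrow> nat d) \<in> {d. d dvd m}"
    "F (int (m div (case t of (e, d) \<Rightarrow> nat d))) (int (case t of (e, d) \<Rightarrow> nat d)) = (case t of (e, d) \<Rightarrow> F e d)"
    using t ed m by simp_all
next
  fix d assume "d \<in> {d. d dvd m}"
  then obtain e where m: "m = d * e" by (auto elim: dvdE)
  show "(case (int (m div d), int d) of (e, d) \<Rightarrow> nat d) = d" by simp
  show "(int (m div d), int d) \<in> dpairs (int m)" using assms m by (auto simp: dpairs_def)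
qed

text \<open>Only divisors of \<open>n1\<close> count, as \<open>chi12\<close> vanishes at multiples
  of 3. In the part with e, passing to the complementary divisor gives
  \<open>chi12 (n1 div d)\<close>, which is \<open>chi12 n1 * chi12 d\<close> because
  \<open>chi12 d\<close> is its own inverse.\<close>

lemma divisor_sum_eisenstein:
  fixes n1 \<beta> :: nat
  assumes "odd n1" "\<not> 3 dvd n1"
  shows "(\<Sum>(e, d) \<in> dpairs (int (3 ^ \<beta> * n1)). chi4 d * chi3 d * (e - d)) =
    (3 ^ \<beta> * chi12 (int n1) - 1) * (\<Sum>d | d dvd n1. int d * chi12 (int d))"
proof -
  have n1: "n1 > 0" using assms(1) by (cases n1) auto
  have "(\<Sum>(e, d) \<in> dpairs (int (3 ^ \<beta> * n1)). chi4 d * chi3 d * (e - d))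
      = (\<Sum>d | d dvd 3 ^ \<beta> * n1. chi12 (int d) * (int (3 ^ \<beta> * n1 div d) - int d))"
    using n1 by (subst sum_dpairs_divisors) (simp_all add: chi12_def)
  also have "\<dots> = (\<Sum>d | d dvd n1. chi12 (int d) * (int (3 ^ \<beta> * n1 div d) - int d))"
  proof (rule sum.mono_neutral_right)
    show "\<forall>d\<in>{d. d dvd 3 ^ \<beta> * n1} - {d. d dvd n1}. chi12 (int d) * (int (3 ^ \<beta> * n1 div d) - int d) = 0"
    proof
      fix d assume d: "d \<in> {d. d dvd 3 ^ \<beta> * n1} - {d. d dvd n1}"
      have "3 dvd d"
      proof (rule ccontr)
        assume "\<not> 3 dvd d"
        moreover have "prime (3 :: nat)" by simp
        ultimately have "coprime d (3 ^ \<beta>)"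
          by (metis coprime_commute coprime_power_right_iff prime_imp_coprime)
        hence "d dvd n1" using d by (simp add: coprime_dvd_mult_right_iff)
        thus False using d by simp
      qed
      hence "chi3 (int d) = 0" by (auto simp: chi3_def)
      thus "chi12 (int d) * (int (3 ^ \<beta> * n1 div d) - int d) = 0" by (simp add: chi12_def)
    qed
  qed (use n1 in auto)
  also have "\<dots> = (\<Sum>d | d dvd n1. 3 ^ \<beta> * (chi12 (int d) * int (n1 div d)) - int d * chi12 (int d))"
  proof (intro sum.cong refl)
    fix d assume "d \<in> {d. d dvd n1}"
    hence "int (3 ^ \<beta> * n1 div d) = 3 ^ \<beta> * int (n1 div d)" by (simp flip: div_mult_swap)
    thus "chi12 (int d) * (int (3 ^ \<beta> * n1 div d) - int d)
      = 3 ^ \<beta> * (chi12 (int d) * int (n1 div d)) - int d * chi12 (int d)"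
      by (simp add: algebra_simps)
  qed
  also have "\<dots> = 3 ^ \<beta> * (\<Sum>d | d dvd n1. chi12 (int d) * int (n1 div d)) - (\<Sum>d | d dvd n1. int d * chi12 (int d))"
    by (simp add: sum_subtractf sum_distrib_left)
  also have "(\<Sum>d | d dvd n1. chi12 (int d) * int (n1 div d)) = (\<Sum>d | d dvd n1. chi12 (int (n1 div d)) * int d)"
    by (rule sum.reindex_bij_witness[where i = "\<lambda>d. n1 div d" and j = "\<lambda>d. n1 div d"])
       (use n1 in \<open>auto elim!: dvdE\<close>)
  also have "\<dots> = (\<Sum>d | d dvd n1. chi12 (int n1) * (int d * chi12 (int d)))"
  proof (intro sum.cong refl)
    fix d assume "d \<in> {d. d dvd n1}"
    then obtain e where e: "n1 = d * e" by (auto elim: dvdE)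
    have "odd d" "\<not> 3 dvd d" using assms unfolding e by auto
    hence "odd (int d)" "\<not> 3 dvd int d" by presburger+
    hence sq: "chi12 (int d) * chi12 (int d) = 1" by (rule chi12_square)
    have "d > 0" using n1 e by auto
    hence "n1 div d = e" using e by simp
    moreover have "chi12 (int n1) = chi12 (int d) * chi12 (int e)" by (simp add: e chi12_mult)
    ultimately show "chi12 (int (n1 div d)) * int d = chi12 (int n1) * (int d * chi12 (int d))"
      using sq by (simp add: algebra_simps)
  qed
  also have "\<dots> = chi12 (int n1) * (\<Sum>d | d dvd n1. int d * chi12 (int d))" by (simp only: sum_distrib_left)
  finally show ?thesis by (simp add: left_diff_distrib)
qed

section \<open>Coefficient comparison\<close>

text \<open>For odd k exactly one coordinate is odd, and exchanging them halves the total
  \<open>4 * R4 k\<close>.\<close>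

lemma card_odd_even_reps:
  assumes k: "k > 0" "odd k"
  shows "int (card {(x, y). odd x \<and> even y \<and> x\<^sup>2 + y\<^sup>2 = k}) = 2 * R4 k"
proof -
  let ?A = "{(x, y). odd x \<and> even y \<and> x\<^sup>2 + y\<^sup>2 = k}"
  let ?B = "{(x, y). even x \<and> odd y \<and> x\<^sup>2 + y\<^sup>2 = k}"
  have q: "qreps 0 k = ?A \<union> ?B" using k(2) by (auto simp: qreps_def qf_def)
  have fin: "finite ?A" "finite ?B"
    by (rule finite_subset[OF _ finite_qreps[of 0 k]]; auto simp: qreps_def qf_def)+
  have "card ?A = card ?B"
    by (rule bij_betw_same_card[of "\<lambda>(x, y). (y, x)"])
       (rule bij_betw_byWitness[where f' = "\<lambda>(x, y). (y, x)"]; auto simp: add.commute)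
  moreover have "card (?A \<union> ?B) = card ?A + card ?B" using fin by (intro card_Un_disjoint) auto
  ultimately show ?thesis using card_qreps_0[OF k(1)] q by simp
qed

lemma th_odd_even_nth:
  assumes "odd j"
  shows "(th_odd 3 * th_even 3) $ j = (if 3 dvd j then 2 * R4 (int j div 3) else 0)"
proof -
  let ?S = "{x :: int. odd x} \<times> {x :: int. even x}"
  have nth: "(th_odd 3 * th_even 3) $ j = int (card {p. p \<in> ?S \<and> pnorm 3 3 p = j})"
    unfolding th_odd_def th_even_def by (subst th_mult) (simp_all add: gf_nth)
  have norm: "int (pnorm 3 3 (x, y)) = 3 * (x\<^sup>2 + y\<^sup>2)" for x y by (simp add: int_nsq)
  show ?thesis
  proof (cases "3 dvd j")
    case True
    then obtain k where k: "j = 3 * k" by (rule dvdE)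
    have iff: "pnorm 3 3 (x, y) = j \<longleftrightarrow> x\<^sup>2 + y\<^sup>2 = int k" for x y
    proof -
      have "pnorm 3 3 (x, y) = j \<longleftrightarrow> int (pnorm 3 3 (x, y)) = int j" by (simp only: of_nat_eq_iff)
      also have "\<dots> \<longleftrightarrow> 3 * (x\<^sup>2 + y\<^sup>2) = 3 * int k" by (simp only: norm k of_nat_mult of_nat_numeral)
      also have "\<dots> \<longleftrightarrow> x\<^sup>2 + y\<^sup>2 = int k" by (rule mult_cancel_left[THEN trans]) simp
      finally show ?thesis .
    qed
    have "{p. p \<in> ?S \<and> pnorm 3 3 p = j} = {(x, y). odd x \<and> even y \<and> x\<^sup>2 + y\<^sup>2 = int k}"
      using iff by auto
    moreover have "odd k" using assms k by simp
    moreover have "k > 0" using \<open>odd k\<close> by (cases k) auto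
    moreover have "int j div 3 = int k" by (simp add: k)
    ultimately show ?thesis using True card_odd_even_reps[of "int k"] by (simp only: nth if_True) simp
  next
    case False
    have "3 dvd j" if "pnorm 3 3 (x, y) = j" for x y
    proof -
      have "int j = 3 * (x\<^sup>2 + y\<^sup>2)" using norm[of x y] that by (simp only:)
      thus ?thesis by presburger
    qed
    hence "{p. p \<in> ?S \<and> pnorm 3 3 p = j} = {}" using False by auto
    thus ?thesis using False by (simp only: nth card.empty if_False of_nat_0)
  qed
qed

text \<open>Pairs of equal parity are x = 2 s + t, y = t, and then x^2 + 3 y^2 = 4 (s^2 + s t +
  t^2).\<close>

lemma th_hexagonal_nth:
  "(th_odd 1 * th_odd 3 + th_even 1 * th_even 3) $ i = (if 4 dvd i then int (card (qreps 1 (int i div 4))) else 0)"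
proof -
  let ?O = "{x :: int. odd x} \<times> {x :: int. odd x}" and ?E = "{x :: int. even x} \<times> {x :: int. even x}"
  have "th_odd 1 * th_odd 3 + th_even 1 * th_even 3
     = gf ?O (pnorm 1 3) (\<lambda>(x, y). 1) + gf ?E (pnorm 1 3) (\<lambda>(x, y). 1)"
    unfolding th_odd_def th_even_def by (subst (1 2) th_mult) simp_all
  also have "\<dots> = gf (?O \<union> ?E) (pnorm 1 3) (\<lambda>(x, y). 1)"
    by (rule gf_union[symmetric, OF finite_fibres_pnorm]) auto
  also have "\<dots> = gf UNIV (\<lambda>p. 4 * (case p of (s, t) \<Rightarrow> nat (qf 1 s t))) (\<lambda>_. 1)"
  proof (rule gf_reindex[where j = "\<lambda>(x, y). ((x - y) div 2, y)" and i = "\<lambda>(s, t). (2 * s + t, t)"], goal_cases)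
    case (3 p)
    then obtain x y where p: "p = (x, y)" "even (x - y)" by auto
    thus ?case by (auto elim!: evenE)
  next
    case (5 p)
    then obtain x y where p: "p = (x, y)" "even (x - y)" by auto
    from p(2) obtain s where s: "x - y = 2 * s" by (rule evenE)
    have x: "x = 2 * s + y" using s by simp
    have "qf 1 s y \<ge> 0" using qf_ge[of 1 s y] zero_le_power2[of s] zero_le_power2[of y] by linarith
    hence "int (4 * nat (qf 1 s y)) = 4 * qf 1 s y" by simp
    also have "\<dots> = int (pnorm 1 3 (x, y))"
      by (simp add: int_nsq qf_def x power2_eq_square algebra_simps)
    finally have "4 * nat (qf 1 s y) = pnorm 1 3 (x, y)" by (simp only: of_nat_eq_iff)
    moreover have "(x - y) div 2 = s" using s by simp
    ultimately show ?case by (simp only: p prod.case)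
  qed auto
  finally have eq: "th_odd 1 * th_odd 3 + th_even 1 * th_even 3
    = gf UNIV (\<lambda>p. 4 * (case p of (s, t) \<Rightarrow> nat (qf 1 s t))) (\<lambda>_. 1)" .
  have "gf UNIV (\<lambda>(s, t). nat (qf 1 s t)) (\<lambda>_. 1) $ m = int (card (qreps 1 (int m)))" for m
  proof -
    have "nat (qf 1 s t) = m \<longleftrightarrow> qf 1 s t = int m" for s t
      using qf_ge[of 1 s t] zero_le_power2[of s] zero_le_power2[of t] by linarith
    hence "{p. p \<in> UNIV \<and> (case p of (s, t) \<Rightarrow> nat (qf 1 s t)) = m} = qreps 1 (int m)"
      by (auto simp: qreps_def)
    thus ?thesis by (simp add: gf_nth)
  qed
  thus ?thesis unfolding eq by (subst gf_scale_nth) (simp_all add: zdiv_int)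
qed

lemma qreps_1_0: "qreps 1 0 = {(0, 0)}"
proof (intro equalityI subsetI)
  fix t assume "t \<in> qreps 1 0"
  then obtain x y where t: "t = (x, y)" "qf 1 x y = 0" by (auto simp: qreps_def)
  have "x\<^sup>2 + y\<^sup>2 \<le> 0" using qf_ge[of 1 x y] t(2) by simp
  thus "t \<in> {(0, 0)}" using t(1) by (simp add: sum_power2_le_zero_iff)
qed (auto simp: qreps_def qf_def)

text \<open>The factor 12 is 2 * 6, from \<open>2 * R4\<close> and \<open>6 * R3\<close>. At L = 0
  the Eisenstein form has one representation instead of a divisor sum, whence the separate term; L =
  N cannot occur since 4 does not divide N.\<close>

lemma th_sum_nth:
  fixes N :: nat
  assumes "N mod 4 = 3"
  shows "(th_odd 3 * th_even 3 * (th_odd 1 * th_odd 3 + th_even 1 * th_even 3)) $ N =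
    12 * char_conv (int N) + (if 3 dvd int N then 2 * R4 (int N div 3) else 0)"
proof -
  let ?F = "\<lambda>L. (th_odd 1 * th_odd 3 + th_even 1 * th_even 3) $ L * (th_odd 3 * th_even 3) $ (N - L)"
  have "(th_odd 3 * th_even 3 * (th_odd 1 * th_odd 3 + th_even 1 * th_even 3)) $ N = (\<Sum>L = 0..N. ?F L)"
    unfolding mult.commute[of "th_odd 3 * th_even 3"] by (rule fps_mult_nth)
  also have "\<dots> = (\<Sum>L \<in> insert 0 {L. 0 < L \<and> L < N \<and> 4 dvd L \<and> 3 dvd N - L}. ?F L)"
  proof (rule sum.mono_neutral_right)
    show "\<forall>L\<in>{0..N} - insert 0 {L. 0 < L \<and> L < N \<and> 4 dvd L \<and> 3 dvd N - L}. ?F L = 0"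
    proof
      fix L assume L: "L \<in> {0..N} - insert 0 {L. 0 < L \<and> L < N \<and> 4 dvd L \<and> 3 dvd N - L}"
      show "?F L = 0"
      proof (cases "4 dvd L")
        case True
        have "L \<noteq> N" using True assms by presburger
        hence "\<not> 3 dvd N - L" "L \<le> N" using L True by auto
        moreover have "odd (N - L)" using True assms \<open>L \<le> N\<close> by presburger
        ultimately show ?thesis by (simp add: th_odd_even_nth)
      next
        case False
        thus ?thesis by (simp only: th_hexagonal_nth if_False mult_zero_left)
      qed
    qed
  qed auto
  also have "\<dots> = ?F 0 + (\<Sum>L | 0 < L \<and> L < N \<and> 4 dvd L \<and> 3 dvd N - L. ?F L)"
    by (subst sum.insert) (auto intro: finite_subset[of _ "{..<N}"])
  also have "?F 0 = (if 3 dvd int N then 2 * R4 (int N div 3) else 0)"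
  proof -
    have "odd N" using assms by presburger
    moreover have "3 dvd N \<longleftrightarrow> 3 dvd int N" by presburger
    ultimately show ?thesis by (simp only: th_hexagonal_nth) (simp add: qreps_1_0 th_odd_even_nth)
  qed
  also have "(\<Sum>L | 0 < L \<and> L < N \<and> 4 dvd L \<and> 3 dvd N - L. ?F L) =
      (\<Sum>L \<in> {L. 0 < L \<and> L < int N \<and> 4 dvd L \<and> 3 dvd int N - L}. 12 * (R4 ((int N - L) div 3) * R3 (L div 4)))"
  proof (rule sum.reindex_bij_witness[where i = nat and j = int])
    fix L assume "L \<in> {L. 0 < L \<and> L < N \<and> 4 dvd L \<and> 3 dvd N - L}"
    hence L: "0 < L" "L < N" "4 dvd L" "3 dvd N - L" by auto
    have NL: "int (N - L) = int N - int L" using L by simp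
    show "nat (int L) = L" by simp
    have "3 dvd int (N - L)" "4 dvd int L" using L by presburger+
    thus "int L \<in> {L. 0 < L \<and> L < int N \<and> 4 dvd L \<and> 3 dvd int N - L}" using L NL by simp
    have "odd (N - L)" using L assms by presburger
    hence "(th_odd 3 * th_even 3) $ (N - L) = 2 * R4 ((int N - int L) div 3)"
      using L NL by (simp add: th_odd_even_nth)
    moreover have "(th_odd 1 * th_odd 3 + th_even 1 * th_even 3) $ L = 6 * R3 (int L div 4)"
    proof -
      have "int L div 4 > 0" using L by (auto elim!: dvdE)
      thus ?thesis using L(3) card_qreps_1[of "int L div 4"] by (simp only: th_hexagonal_nth if_True)
    qed
    ultimately show "12 * (R4 ((int N - int L) div 3) * R3 (int L div 4)) = ?F L" by simp
  next
    fix L assume L: "L \<in> {L. 0 < L \<and> L < int N \<and> 4 dvd L \<and> 3 dvd int N - L}"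
    then obtain l where l: "L = int l" by (auto intro: that[of "nat L"])
    have "l < N" using L by (simp add: l)
    hence eq: "int N - int l = int (N - l)" by simp
    have "3 dvd int N - int l" "4 dvd int l" using L by (simp_all add: l)
    hence "3 dvd N - l" "4 dvd l" unfolding eq by presburger+
    thus "nat L \<in> {L. 0 < L \<and> L < N \<and> 4 dvd L \<and> 3 dvd N - L}" using L l by simp
    show "int (nat L) = L" using l by simp
  qed
  finally show ?thesis by (simp add: char_conv_def sum_distrib_left)
qed

text \<open>Completing squares turns 8 n into the sum of squares minus 1 + 3 + 3 + 12. The last
  variable becomes 4 w - 2, whereas the series allows every even u; modulo 8 the multiples of 4 are
  excluded.\<close>

lemma tri_reps_nth:
  fixes n :: nat
  shows "int (tri_reps 1 3 3 12 n) = (th_odd 1 * th_odd 3 * (th_odd 3 * th_even 3)) $ (8 * n + 19)"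
proof -
  let ?O = "{x :: int. odd x}" and ?E = "{x :: int. even x}"
  let ?N = "8 * n + 19"
  let ?T = "{(x :: int, y :: int, z :: int, w :: int).
     int n = int 1 * (x * (x - 1) div 2) + int 3 * (y * (y - 1) div 2)
           + int 3 * (z * (z - 1) div 2) + int 12 * (w * (w - 1) div 2)}"
  let ?A = "{p. p \<in> (?O \<times> ?O) \<times> (?O \<times> ?E) \<and> (case p of (s, t) \<Rightarrow> pnorm 1 3 s + pnorm 3 3 t) = ?N}"
  have "th_odd 1 * th_odd 3 * (th_odd 3 * th_even 3)
    = gf (?O \<times> ?O) (pnorm 1 3) (\<lambda>(x, y). 1) * gf (?O \<times> ?E) (pnorm 3 3) (\<lambda>(x, y). 1)"
    unfolding th_odd_def th_even_def by (subst (1 2) th_mult) simp_all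
  also have "\<dots> = gf ((?O \<times> ?O) \<times> (?O \<times> ?E)) (\<lambda>(s, t). pnorm 1 3 s + pnorm 3 3 t)
      (\<lambda>(s, t). (case s of (x, y) \<Rightarrow> 1) * (case t of (x, y) \<Rightarrow> 1))"
    by (rule gf_mult) (rule finite_fibres_pnorm; simp)+
  finally have nth: "(th_odd 1 * th_odd 3 * (th_odd 3 * th_even 3)) $ ?N = int (card ?A)"
    by (simp add: gf_nth case_prod_unfold)
  have norm: "(case ((x, y), (z, u)) of (s, t) \<Rightarrow> pnorm 1 3 s + pnorm 3 3 t) = ?N \<longleftrightarrow>
     x\<^sup>2 + 3 * y\<^sup>2 + 3 * z\<^sup>2 + 3 * u\<^sup>2 = 8 * int n + 19" for x y z u
  proof -
    have "(case ((x, y), (z, u)) of (s, t) \<Rightarrow> pnorm 1 3 s + pnorm 3 3 t) = ?N \<longleftrightarrow>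
      int (nsq x + 3 * nsq y + (3 * nsq z + 3 * nsq u)) = int ?N"
      unfolding of_nat_eq_iff by simp
    thus ?thesis by (simp add: int_nsq add.assoc)
  qed
  have tri: "(2 * x - 1)\<^sup>2 = 8 * (x * (x - 1) div 2) + 1" for x :: int
  proof -
    have "even (x * (x - 1))" by simp
    hence "2 * (x * (x - 1) div 2) = x * (x - 1)" by simp
    moreover have "(2 * x - 1)\<^sup>2 = 4 * (x * (x - 1)) + 1" by (simp add: power2_eq_square algebra_simps)
    ultimately show ?thesis by linarith
  qed
  have T_iff: "(x, y, z, w) \<in> ?T \<longleftrightarrow>
     (2 * x - 1)\<^sup>2 + 3 * (2 * y - 1)\<^sup>2 + 3 * (2 * z - 1)\<^sup>2 + 3 * (4 * w - 2)\<^sup>2 = 8 * int n + 19" for x y z w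
  proof -
    have "(4 * w - 2)\<^sup>2 = 4 * (2 * w - 1)\<^sup>2" by (simp add: power2_eq_square algebra_simps)
    thus ?thesis unfolding tri by simp (auto simp: tri)
  qed
  have inv: "\<exists>a b c d. x = 2 * a - 1 \<and> y = 2 * b - 1 \<and> z = 2 * c - 1 \<and> u = 4 * d - 2"
    if xyz: "odd x" "odd y" "odd z" "even u" and eq: "x\<^sup>2 + 3 * y\<^sup>2 + 3 * z\<^sup>2 + 3 * u\<^sup>2 = 8 * int n + 19"
    for x y z u :: int
  proof -
    have "\<not> 4 dvd u"
    proof
      assume "4 dvd u"
      hence "u\<^sup>2 mod 8 = 0" by (rule square_mod_8)
      moreover have "x\<^sup>2 mod 8 = 1" "y\<^sup>2 mod 8 = 1" "z\<^sup>2 mod 8 = 1" using xyz by (auto intro: square_mod_8)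
      ultimately show False using eq by presburger
    qed
    hence "u = 4 * ((u + 2) div 4) - 2" using xyz(4) by presburger
    moreover have "x = 2 * ((x + 1) div 2) - 1" "y = 2 * ((y + 1) div 2) - 1" "z = 2 * ((z + 1) div 2) - 1"
      using xyz by presburger+
    ultimately show ?thesis by blast
  qed
  define f :: "int \<times> int \<times> int \<times> int \<Rightarrow> (int \<times> int) \<times> (int \<times> int)" where
    "f = (\<lambda>(x, y, z, w). ((2 * x - 1, 2 * y - 1), (2 * z - 1, 4 * w - 2)))"
  define g :: "(int \<times> int) \<times> (int \<times> int) \<Rightarrow> int \<times> int \<times> int \<times> int" where
    "g = (\<lambda>((x, y), (z, u)). ((x + 1) div 2, (y + 1) div 2, (z + 1) div 2, (u + 2) div 4))"
  have gf: "g (f t) = t" for t by (auto simp: f_def g_def split: prod.splits)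
  have fT: "f t \<in> ?A" if tT: "t \<in> ?T" for t
  proof -
    obtain x y z w where t: "t = (x, y, z, w)" by (metis surj_pair)
    have "(2 * x - 1)\<^sup>2 + 3 * (2 * y - 1)\<^sup>2 + 3 * (2 * z - 1)\<^sup>2 + 3 * (4 * w - 2)\<^sup>2 = 8 * int n + 19"
      using tT unfolding t T_iff .
    hence "(case ((2 * x - 1, 2 * y - 1), (2 * z - 1, 4 * w - 2)) of (s, t) \<Rightarrow> pnorm 1 3 s + pnorm 3 3 t) = ?N"
      unfolding norm .
    thus ?thesis by (simp add: t f_def)
  qed
  have gA: "f (g p) = p \<and> g p \<in> ?T" if pA: "p \<in> ?A" for p
  proof -
    obtain x y z u where p: "p = ((x, y), (z, u))" by (metis surj_pair)
    from pA have eq: "x\<^sup>2 + 3 * y\<^sup>2 + 3 * z\<^sup>2 + 3 * u\<^sup>2 = 8 * int n + 19"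
      and "odd x" "odd y" "odd z" "even u" using norm[of x y z u] unfolding p by auto
    then obtain a b c d where abcd: "x = 2 * a - 1" "y = 2 * b - 1" "z = 2 * c - 1" "u = 4 * d - 2"
      using inv[of x y z u] by auto
    have "(a, b, c, d) \<in> ?T" using eq unfolding T_iff abcd .
    moreover have "p = f (a, b, c, d)" by (simp add: p abcd f_def)
    ultimately show ?thesis by (simp only: gf)
  qed
  have "bij_betw f ?T ?A"
    by (rule bij_betw_byWitness[where f' = g];
        intro ballI image_subsetI gf fT conjunct1[OF gA] conjunct2[OF gA]; assumption)
  hence "card ?T = card ?A" by (rule bij_betw_same_card)
  thus ?thesis unfolding nth tri_reps_def by (simp only:)
qed

lemma chi4_nat_odd:
  assumes "odd a"
  shows "chi4 (int a) = (-1) ^ ((a - 1) div 2)"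
proof -
  from assms obtain k where k: "a = 2 * k + 1" by (rule oddE)
  show ?thesis
  proof (cases "even k")
    case True
    then obtain l where "k = 2 * l" by (rule evenE)
    thus ?thesis by (simp add: k chi4_def)
  next
    case False
    then obtain l where "k = 2 * l + 1" by (rule oddE)
    hence "int a = 4 * int l + 3" by (simp add: k)
    thus ?thesis using False by (simp add: k chi4_def)
  qed
qed

text \<open>Both sides are reduced to the sum of \<open>chi4 v * v\<close> over \<open>C\<close>. On
  the left the sign \<open>sg u\<close> is 1 since N = 3 (mod 8) forces 4 | u; on the right each
  pair (v, u) accounts for a signed pair (a, b).\<close>

lemma cusp_sum:
  fixes N :: nat
  assumes N: "N mod 8 = 3"
  shows "- (th_chi 3 * th_alt 1) $ N =
    (\<Sum>(a, b) \<in> {(a :: nat, b :: nat). a > 0 \<and> b > 0 \<and> odd a \<and> odd b \<and> 4 * N = a\<^sup>2 + 3 * b\<^sup>2}.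
       chi4 (int a) * int a + chi4 (int b) * int b)"
proof -
  let ?h = "\<lambda>(a, b). chi4 a * a + chi4 b * b"
  define B where "B = {(a :: int, b :: int). odd a \<and> odd b \<and> a\<^sup>2 + 3 * b\<^sup>2 = 4 * int N}"
  define C where "C = {(v :: int, u :: int). odd v \<and> 4 dvd u \<and> 3 * v\<^sup>2 + u\<^sup>2 = int N}"
  have Nm: "int N mod 8 = 3" using N by presburger
  have dvd4: "4 dvd u" if "odd v" "even u" "3 * v\<^sup>2 + u\<^sup>2 = int N" for u v :: int
  proof (rule ccontr)
    assume "\<not> 4 dvd u"
    hence "u mod 4 = 2" using that(2) by presburger
    hence "u\<^sup>2 mod 8 = 4" by (rule square_mod_8)
    moreover have "v\<^sup>2 mod 8 = 1" using that(1) by (rule square_mod_8)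
    ultimately show False using that(3) Nm by presburger
  qed
  have bnd: "a \<in> {- 4 * int N..4 * int N}" if "a\<^sup>2 \<le> 4 * int N" for a
    using abs_le_square_int[of a] that by (simp; linarith)
  have finB: "finite B"
  proof (rule finite_subset)
    show "B \<subseteq> {- 4 * int N..4 * int N} \<times> {- 4 * int N..4 * int N}"
    proof
      fix t assume "t \<in> B"
      then obtain a b where t: "t = (a, b)" "a\<^sup>2 + 3 * b\<^sup>2 = 4 * int N" by (auto simp: B_def)
      have "a\<^sup>2 \<le> 4 * int N" "b\<^sup>2 \<le> 4 * int N"
        using t(2) zero_le_power2[of a] zero_le_power2[of b] by linarith+
      thus "t \<in> {- 4 * int N..4 * int N} \<times> {- 4 * int N..4 * int N}" using bnd t(1) by blast
    qed
  qed auto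
  have nth: "(th_chi 3 * th_alt 1) $ N = (\<Sum>(v, u) \<in> C. chi4 v * v)"
  proof -
    have "(th_chi 3 * th_alt 1) $ N
      = (\<Sum>p | p \<in> {x. odd x} \<times> {x. even x} \<and> pnorm 3 1 p = N. case p of (v, u) \<Rightarrow> chi4 v * v * sg u)"
      unfolding th_chi_def th_alt_def by (subst th_mult) (simp_all add: gf_nth)
    also have "\<dots> = (\<Sum>(v, u) \<in> C. chi4 v * v)"
    proof (rule sum.cong)
      have iff: "pnorm 3 1 (v, u) = N \<longleftrightarrow> 3 * v\<^sup>2 + u\<^sup>2 = int N" for v u
      proof -
        have "pnorm 3 1 (v, u) = N \<longleftrightarrow> int (pnorm 3 1 (v, u)) = int N" by (simp only: of_nat_eq_iff)
        thus ?thesis by (simp add: int_nsq)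
      qed
      show "{p. p \<in> {x. odd x} \<times> {x. even x} \<and> pnorm 3 1 p = N} = C"
      proof (intro equalityI subsetI)
        fix p assume p: "p \<in> {p. p \<in> {x. odd x} \<times> {x. even x} \<and> pnorm 3 1 p = N}"
        obtain v u where vu: "p = (v, u)" by (metis surj_pair)
        have "odd v" "even u" "3 * v\<^sup>2 + u\<^sup>2 = int N" using p iff[of v u] unfolding vu by auto
        thus "p \<in> C" using dvd4 by (simp add: C_def vu)
      next
        fix p assume "p \<in> C"
        then obtain v u where vu: "p = (v, u)" "odd v" "4 dvd u" "3 * v\<^sup>2 + u\<^sup>2 = int N" by (auto simp: C_def)
        have "even u" using vu(3) by presburger
        thus "p \<in> {p. p \<in> {x. odd x} \<times> {x. even x} \<and> pnorm 3 1 p = N}" using vu iff[of v u] by simp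
      qed
    qed (auto simp: C_def sg_def)
    finally show ?thesis .
  qed
  let ?U = "{(a, b) \<in> B. 4 dvd a - b}" and ?V = "{(a, b) \<in> B. 4 dvd a + b}"
  have "sum ?h B = sum ?h ?U + sum ?h ?V"
  proof -
    have "B = ?U \<union> ?V" unfolding B_def by auto presburger
    moreover have "?U \<inter> ?V = {}" unfolding B_def by auto presburger
    moreover have "finite ?U" "finite ?V" by (rule finite_subset[OF _ finB]; auto)+
    ultimately show ?thesis using sum.union_disjoint[of ?U ?V ?h] by simp
  qed
  also have "sum ?h ?V = sum ?h ?U"
    by (rule sum.reindex_bij_witness[where i = "\<lambda>(a, b). (a, - b)" and j = "\<lambda>(a, b). (a, - b)"])
       (auto simp: B_def chi4_minus)
  \<comment> \<open>With r a square root of -3, the substitution is a + b r = (1 + r) (u - v r),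
    where 1 + r is twice a primitive sixth root of unity; hence the norm is multiplied by 4.\<close>
  also have "sum ?h ?U = (\<Sum>(v, u) \<in> C. - chi4 v * (2 * u + 2 * v))"
  proof (rule sum.reindex_bij_witness[where i = "\<lambda>(v, u). (u + 3 * v, u - v)" and j = "\<lambda>(a, b). ((a - b) div 4, b + (a - b) div 4)"])
    fix t assume "t \<in> ?U"
    then obtain a b where t: "t = (a, b)" "odd a" "odd b" "a\<^sup>2 + 3 * b\<^sup>2 = 4 * int N" "4 dvd a - b"
      by (auto simp: B_def)
    from t(5) obtain v where v: "a - b = 4 * v" by (rule dvdE)
    define u where "u = b + v"
    have ab: "a = u + 3 * v" "b = u - v" using v by (simp_all add: u_def)
    have j: "(case t of (a, b) \<Rightarrow> ((a - b) div 4, b + (a - b) div 4)) = (v, u)"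
      by (simp add: t(1) v u_def)
    have "4 * (3 * v\<^sup>2 + u\<^sup>2) = 4 * int N"
      unfolding t(4)[symmetric] ab by (simp add: power2_eq_square algebra_simps)
    hence eq: "3 * v\<^sup>2 + u\<^sup>2 = int N" by simp
    have "odd v"
    proof (rule ccontr)
      assume "\<not> odd v"
      then obtain w where w: "v = 2 * w" by (auto elim: evenE)
      have "odd u" using \<open>\<not> odd v\<close> t(3) unfolding ab by simp
      hence "u\<^sup>2 mod 8 = 1" by (rule square_mod_8)
      moreover have "12 * w\<^sup>2 + u\<^sup>2 = int N" using eq by (simp add: w power_mult_distrib)
      ultimately show False using Nm by presburger
    qed
    moreover have "even u" using \<open>odd v\<close> t(3) unfolding ab by simp
    ultimately have C: "odd v" "4 dvd u" using dvd4 eq by auto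
    show "(case t of (a, b) \<Rightarrow> ((a - b) div 4, b + (a - b) div 4)) \<in> C"
      unfolding j using C eq by (simp add: C_def)
    show "(case case t of (a, b) \<Rightarrow> ((a - b) div 4, b + (a - b) div 4) of (v, u) \<Rightarrow> (u + 3 * v, u - v)) = t"
      unfolding j by (simp add: t(1) ab)
    \<comment> \<open>As 4 | u, modulo 4 one has a = 3 v and b = -v; and a + b = 2 u + 2 v.\<close>
    have "chi4 a = - chi4 v" "chi4 b = - chi4 v" using C unfolding ab chi4_def by presburger+
    thus "(case case t of (a, b) \<Rightarrow> ((a - b) div 4, b + (a - b) div 4) of (v, u) \<Rightarrow> - chi4 v * (2 * u + 2 * v)) = ?h t"
      unfolding j by (simp add: t(1) ab algebra_simps)
  next
    fix t assume "t \<in> C"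
    then obtain v u where t: "t = (v, u)" "odd v" "4 dvd u" "3 * v\<^sup>2 + u\<^sup>2 = int N" by (auto simp: C_def)
    show "(case case t of (v, u) \<Rightarrow> (u + 3 * v, u - v) of (a, b) \<Rightarrow> ((a - b) div 4, b + (a - b) div 4)) = t"
      by (simp add: t(1))
    have "even u" using t(3) by presburger
    moreover have "(u + 3 * v)\<^sup>2 + 3 * (u - v)\<^sup>2 = 4 * int N"
      unfolding t(4)[symmetric] by (simp add: power2_eq_square algebra_simps)
    ultimately show "(case t of (v, u) \<Rightarrow> (u + 3 * v, u - v)) \<in> ?U" using t(2) by (simp add: t(1) B_def)
  qed
  also have "\<dots> = - 2 * (\<Sum>(v, u) \<in> C. chi4 v * u) - 2 * (\<Sum>(v, u) \<in> C. chi4 v * v)"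
    unfolding sum_distrib_left sum_subtractf[symmetric]
    by (intro sum.cong refl) (auto simp: algebra_simps)
  also have "(\<Sum>(v, u) \<in> C. chi4 v * u) = 0"
  proof -
    have "(\<Sum>(v, u) \<in> C. chi4 v * u) = (\<Sum>(v, u) \<in> C. - (chi4 v * u))"
      by (rule sum.reindex_bij_witness[where i = "\<lambda>(v, u). (v, - u)" and j = "\<lambda>(v, u). (v, - u)"])
         (auto simp: C_def)
    thus ?thesis by (simp add: sum_negf case_prod_unfold)
  qed
  finally have hB: "sum ?h B = - 4 * (\<Sum>(v, u) \<in> C. chi4 v * v)" by simp
  have sgnB: "a < 0 \<or> a > 0" "b < 0 \<or> b > 0" if "(a, b) \<in> B" for a b
  proof -
    have "a \<noteq> 0" "b \<noteq> 0" using that by (auto simp: B_def)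
    thus "a < 0 \<or> a > 0" "b < 0 \<or> b > 0" by auto
  qed
  \<comment> \<open>The weight is even in a and in b, so the four sign choices contribute equally
    and the factor -4 in \<open>hB\<close> becomes -1.\<close>
  let ?P = "{(a, b) \<in> B. a > 0}" and ?PP = "{(a, b) \<in> B. a > 0 \<and> b > 0}"
  have "sum ?h B = sum ?h ?P + sum ?h {(a, b) \<in> B. a < 0}"
  proof -
    have "B = ?P \<union> {(a, b) \<in> B. a < 0}" using sgnB(1) by auto
    moreover have "?P \<inter> {(a, b) \<in> B. a < 0} = {}" by auto
    moreover have "finite ?P" "finite {(a, b) \<in> B. a < 0}" by (rule finite_subset[OF _ finB]; auto)+
    ultimately show ?thesis using sum.union_disjoint[of ?P "{(a, b) \<in> B. a < 0}" ?h] by simp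
  qed
  also have "sum ?h {(a, b) \<in> B. a < 0} = sum ?h ?P"
    by (rule sum.reindex_bij_witness[where i = "\<lambda>(a, b). (- a, b)" and j = "\<lambda>(a, b). (- a, b)"])
       (auto simp: B_def chi4_minus)
  also have "sum ?h ?P = sum ?h ?PP + sum ?h {(a, b) \<in> B. a > 0 \<and> b < 0}"
  proof -
    have "?P = ?PP \<union> {(a, b) \<in> B. a > 0 \<and> b < 0}" using sgnB(2) by auto
    moreover have "?PP \<inter> {(a, b) \<in> B. a > 0 \<and> b < 0} = {}" by auto
    moreover have "finite ?PP" "finite {(a, b) \<in> B. a > 0 \<and> b < 0}" by (rule finite_subset[OF _ finB]; auto)+
    ultimately show ?thesis using sum.union_disjoint[of ?PP "{(a, b) \<in> B. a > 0 \<and> b < 0}" ?h] by simp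
  qed
  also have "sum ?h {(a, b) \<in> B. a > 0 \<and> b < 0} = sum ?h ?PP"
    by (rule sum.reindex_bij_witness[where i = "\<lambda>(a, b). (a, - b)" and j = "\<lambda>(a, b). (a, - b)"])
       (auto simp: B_def chi4_minus)
  finally have "sum ?h ?PP = - (\<Sum>(v, u) \<in> C. chi4 v * v)" using hB by simp
  moreover have "sum ?h ?PP = (\<Sum>(a, b) \<in> {(a :: nat, b :: nat). a > 0 \<and> b > 0 \<and> odd a \<and> odd b \<and> 4 * N = a\<^sup>2 + 3 * b\<^sup>2}.
       chi4 (int a) * int a + chi4 (int b) * int b)"
  proof (rule sum.reindex_bij_witness[where i = "\<lambda>(a, b). (int a, int b)" and j = "\<lambda>(a, b). (nat a, nat b)"])
    have iff: "(int a)\<^sup>2 + 3 * (int b)\<^sup>2 = 4 * int N \<longleftrightarrow> 4 * N = a\<^sup>2 + 3 * b\<^sup>2" for a b :: nat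
    proof -
      have "4 * N = a\<^sup>2 + 3 * b\<^sup>2 \<longleftrightarrow> int (4 * N) = int (a\<^sup>2 + 3 * b\<^sup>2)" by (simp only: of_nat_eq_iff)
      thus ?thesis by (simp add: eq_commute)
    qed
    {
      fix t assume "t \<in> {(a :: nat, b :: nat). a > 0 \<and> b > 0 \<and> odd a \<and> odd b \<and> 4 * N = a\<^sup>2 + 3 * b\<^sup>2}"
      thus "(case t of (a, b) \<Rightarrow> (int a, int b)) \<in> ?PP"
        "(case case t of (a, b) \<Rightarrow> (int a, int b) of (a, b) \<Rightarrow> (nat a, nat b)) = t"
        using iff by (auto simp: B_def)
    }
    fix t assume "t \<in> ?PP"
    then obtain a b where t: "t = (a, b)" "a > 0" "b > 0" "(a, b) \<in> B" by auto
    then obtain a' b' where ab: "a = int a'" "b = int b'" by (metis less_imp_le zero_le_imp_eq_int)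
    show "(case case t of (a, b) \<Rightarrow> (nat a, nat b) of (a, b) \<Rightarrow> (int a, int b)) = t"
      "(case case t of (a, b) \<Rightarrow> (nat a, nat b) of (a, b) \<Rightarrow> chi4 (int a) * int a + chi4 (int b) * int b) = ?h t"
      by (simp_all add: t(1) ab)
    show "(case t of (a, b) \<Rightarrow> (nat a, nat b)) \<in> {(a :: nat, b :: nat). a > 0 \<and> b > 0 \<and> odd a \<and> odd b \<and> 4 * N = a\<^sup>2 + 3 * b\<^sup>2}"
      using t iff[of a' b'] by (simp add: ab B_def)
  qed
  ultimately show ?thesis unfolding fps_neg_nth nth by simp
qed

theorem theorem4p4:
  fixes n n1 \<beta> :: nat
  assumes "n > 0"
    and "8 * n + 19 = 3 ^ \<beta> * n1"
    and "n1 > 0"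
    and "\<not> 3 dvd n1"
  shows "real (tri_reps 1 3 3 12 n) =
    1 / 2 * (3 ^ \<beta> * real_of_int (kronecker 3 (int n1)) - 1)
        * (\<Sum>d | d dvd n1. real d * real_of_int (kronecker 3 (int d)))
    + 1 / 2 * (\<Sum>(a, b) \<in> {(a :: nat, b :: nat). a > 0 \<and> b > 0 \<and>
                  [a = 1] (mod 2) \<and> [b = 1] (mod 2) \<and>
                  4 * (8 * n + 19) = a ^ 2 + 3 * b ^ 2}.
        (-1) ^ ((a - 1) div 2) * real a + (-1) ^ ((b - 1) div 2) * real b)"
proof -
  define N where "N = 8 * n + 19"
  let ?S = "{(a :: nat, b :: nat). a > 0 \<and> b > 0 \<and> odd a \<and> odd b \<and> 4 * N = a\<^sup>2 + 3 * b\<^sup>2}"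
  have N8: "N mod 8 = 3" and N4: "N mod 4 = 3" unfolding N_def by presburger+
  have "odd N" using N8 by presburger
  hence odd_n1: "odd n1" using assms(2) by (simp add: N_def)
  \<comment> \<open>All divisors of \<open>n1\<close> are odd, which is what allows
    \<open>chi12\<close> to stand for the Kronecker symbol.\<close>
  have kr: "kronecker 3 (int d) = chi12 (int d)" if "d dvd n1" for d
  proof -
    have "d > 0" using that assms(3) by (cases d) auto
    moreover have "odd d" using that odd_n1 by (meson dvd_trans)
    ultimately show ?thesis by (intro kronecker_3) auto
  qed
  have "2 * (th_odd 1 * th_odd 3 * (th_odd 3 * th_even 3))
     = th_odd 3 * th_even 3 * (th_odd 1 * th_odd 3 + th_even 1 * th_even 3)
     + th_odd 3 * th_even 3 * (th_odd 1 * th_odd 3 - th_even 1 * th_even 3)"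
    by (simp add: algebra_simps)
  also have "th_odd 3 * th_even 3 * (th_odd 1 * th_odd 3 - th_even 1 * th_even 3) = - (th_chi 3 * th_alt 1)"
    by (rule th_difference)
  finally have "(2 * (th_odd 1 * th_odd 3 * (th_odd 3 * th_even 3))) $ N
     = (th_odd 3 * th_even 3 * (th_odd 1 * th_odd 3 + th_even 1 * th_even 3) + - (th_chi 3 * th_alt 1)) $ N"
    by (rule arg_cong)
  hence "2 * int (tri_reps 1 3 3 12 n) =
      (th_odd 3 * th_even 3 * (th_odd 1 * th_odd 3 + th_even 1 * th_even 3)) $ N + - (th_chi 3 * th_alt 1) $ N"
    by (simp only: tri_reps_nth N_def mult_2 fps_add_nth fps_neg_nth)
  also have "(th_odd 3 * th_even 3 * (th_odd 1 * th_odd 3 + th_even 1 * th_even 3)) $ N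
     = (\<Sum>(e, d) \<in> dpairs (int N). chi4 d * chi3 d * (e - d))"
  proof -
    have "int N mod 4 = 3" using N4 by presburger
    thus ?thesis unfolding th_sum_nth[OF N4] by (rule char_conv_eq)
  qed
  also have "int N = int (3 ^ \<beta> * n1)" by (simp only: N_def assms(2))
  also note divisor_sum_eisenstein[OF odd_n1 assms(4)]
  also note cusp_sum[OF N8]
  finally have main: "2 * int (tri_reps 1 3 3 12 n) =
      (3 ^ \<beta> * chi12 (int n1) - 1) * (\<Sum>d | d dvd n1. int d * chi12 (int d))
      + (\<Sum>(a, b) \<in> ?S. chi4 (int a) * int a + chi4 (int b) * int b)" .
  have "2 * real (tri_reps 1 3 3 12 n) = real_of_int (2 * int (tri_reps 1 3 3 12 n))" by simp
  also have "\<dots> = (3 ^ \<beta> * real_of_int (chi12 (int n1)) - 1) * (\<Sum>d | d dvd n1. real d * real_of_int (chi12 (int d)))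
      + (\<Sum>(a, b) \<in> ?S. real_of_int (chi4 (int a)) * real a + real_of_int (chi4 (int b)) * real b)"
    unfolding main by (simp add: case_prod_unfold)
  also have "(\<Sum>(a, b) \<in> ?S. real_of_int (chi4 (int a)) * real a + real_of_int (chi4 (int b)) * real b)
    = (\<Sum>(a, b) \<in> ?S. (-1) ^ ((a - 1) div 2) * real a + (-1) ^ ((b - 1) div 2) * real b)"
    by (intro sum.cong refl) (auto simp: chi4_nat_odd)
  also have "?S = {(a :: nat, b :: nat). a > 0 \<and> b > 0 \<and> [a = 1] (mod 2) \<and> [b = 1] (mod 2) \<and>
                  4 * (8 * n + 19) = a ^ 2 + 3 * b ^ 2}"
    by (simp add: N_def cong_def odd_iff_mod_2_eq_one)
  also have "(\<Sum>d | d dvd n1. real d * real_of_int (chi12 (int d)))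
    = (\<Sum>d | d dvd n1. real d * real_of_int (kronecker 3 (int d)))"
    by (intro sum.cong refl) (simp add: kr)
  also have "chi12 (int n1) = kronecker 3 (int n1)" by (simp add: kr)
  finally show ?thesis by simp
qed

end
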